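(* Let $T$ be an operator function on an interval $\Delta\subset\mathbb R$ satisfying Assumptions (A1)–(A3) and condition (VM). Let $\mu_1,\mu_2\in\Delta$ with $\mu_1<\mu_2$. If there exist $\mathcal M\in\mathbb M^+_{\mu_1}$ and $a>0$ such that $$\mathfrak t(\mu_2)[x]\ge a\|x\|^2\quad\text{for all }x\in\mathcal M,$$ then $\mu_2\in\rho(T)$.
   Context: $\mathcal H$ is a complex Hilbert space; "subspace" means linear manifold, not necessarily closed. For a self-adjoint operator $A$ with spectral measure $E$, its form is $\mathfrak a[x,y]=\int_{\mathbb R}\mu\,d\langle E(\mu)x,y\rangle$ for $x,y\in\mathrm{dom}(\mathfrak a):=\mathrm{dom}(|A|^{1/2})$, and $\mathfrak a[x]:=\mathfrak a[x,x]$ (so $\mathfrak a[x,y]=\langle Ax,y\rangle$ for $x\in\mathrm{dom}A$, $y\in\mathrm{dom}\,\mathfrak a$). A subspace $\mathcal L\subset\mathrm{dom}(\mathfrak a)$ is $\mathfrak a$-non-negative if $\mathfrak a[x]\ge0$ for all $x\in\mathcal L$; it is maximal $\mathfrak a$-non-negative if it is not properly contained in another $\mathfrak a$-non-negative subspace of $\mathrm{dom}(\mathfrak a)$. For an operator function $T$ on $\Delta$ with closed operator values: $\sigma(T)=\{\lambda\in\Delta:0\in\sigma(T(\lambda))\}$, $\rho(T)=\{\lambda\in\Delta:0\in\rho(T(\lambda))\}$. Assumptions: (A1) $T(\lambda)$ is self-adjoint for each $\lambda\in\Delta$, with form $\mathfrak t(\lambda)$; (A2) $\mathrm{dom}\,\mathfrak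 t(\lambda)=\mathrm{dom}(|T(\lambda)|^{1/2})=:\mathcal D$ is independent of $\lambda$; (A3) for each $x\in\mathcal D\setminus\{0\}$, $\lambda\mapsto\mathfrak t(\lambda)[x]$ is continuous on $\Delta$, and if $\mathfrak t(\lambda_0)[x]=0$ for some $\lambda_0\in\Delta$ then $\mathfrak t(\lambda)[x]>0$ for $\lambda\in\Delta$, $\lambda<\lambda_0$, and $\mathfrak t(\lambda)[x]<0$ for $\lambda\in\Delta$, $\lambda>\lambda_0$. Condition (VM): for every $u\in\mathcal D$ the function $\mathfrak t(\cdot)[u]$ is differentiable on $\Delta$ (derivative denoted $\mathfrak t'(\lambda)[u]$), and for every compact subinterval $I\subset\Delta$ there exist $\varepsilon,\delta>0$ such that for all $x\in\mathcal D$ with $\|x\|=1$ and all $\lambda\in I$: $|\mathfrak t(\lambda)[x]|\le\varepsilon\Rightarrow\mathfrak t'(\lambda)[x]\le-\delta$. For $\gamma\in\Delta$, $\mathbb M^+_\gamma$ is the set of all maximal $\mathfrak t(\gamma)$-non-negative subspaces of $\mathcal D$. *)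

theory Defs
  imports "HOL-Analysis.Analysis" "HOL-Probability.Probability"
begin

class complex_vector = real_vector +
  fixes scaleC :: "complex \<Rightarrow> 'a \<Rightarrow> 'a" (infixr \<open>*\<^sub>C\<close> 75)
  assumes scaleC_add_right: "c *\<^sub>C (x + y) = c *\<^sub>C x + c *\<^sub>C y"
    and scaleC_add_left: "(b + c) *\<^sub>C x = b *\<^sub>C x + c *\<^sub>C x"
    and scaleC_scaleC: "b *\<^sub>C (c *\<^sub>C x) = (b * c) *\<^sub>C x"
    and scaleC_one: "1 *\<^sub>C x = x"
    and scaleR_scaleC: "scaleR r x = complex_of_real r *\<^sub>C x"

class complex_inner = complex_vector + real_normed_vector +
  fixes cinner :: "'a \<Rightarrow> 'a \<Rightarrow> complex"
  assumes cinner_conj_commute: "cinner x y = cnj (cinner y x)"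
    and cinner_add_left: "cinner (x + y) z = cinner x z + cinner y z"
    and cinner_scaleC_left: "cinner (c *\<^sub>C x) y = c * cinner x y"
    and cinner_self_real: "Im (cinner x x) = 0"
    and cinner_self_nonneg: "Re (cinner x x) \<ge> 0"
    and cinner_self_eq_zero: "cinner x x = 0 \<longleftrightarrow> x = 0"
    and norm_eq_sqrt_cinner: "norm x = sqrt (Re (cinner x x))"

class chilbert_space = complex_inner + complete_space

definition csubspace :: "'a::complex_vector set \<Rightarrow> bool" where
  "csubspace S \<longleftrightarrow> 0 \<in> S \<and> (\<forall>x\<in>S. \<forall>y\<in>S. x + y \<in> S) \<and> (\<forall>c. \<forall>x\<in>S. c *\<^sub>C x \<in> S)"

text \<open>An operator is given by its domain D together with a map A
(values outside D are irrelevant). Self-adjointness: densely defined, linear,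
and the graph of the adjoint equals the graph of A.\<close>
definition self_adjoint :: "'a::chilbert_space set \<Rightarrow> ('a \<Rightarrow> 'a) \<Rightarrow> bool" where
  "self_adjoint D A \<longleftrightarrow>
     csubspace D \<and> closure D = UNIV \<and>
     (\<forall>x\<in>D. \<forall>y\<in>D. A (x + y) = A x + A y) \<and>
     (\<forall>c. \<forall>x\<in>D. A (c *\<^sub>C x) = c *\<^sub>C A x) \<and>
     (\<forall>y z. (\<forall>x\<in>D. cinner (A x) y = cinner x z) \<longleftrightarrow> (y \<in> D \<and> z = A y))"

definition zero_in_resolvent :: "'a::chilbert_space set \<Rightarrow> ('a \<Rightarrow> 'a) \<Rightarrow> bool" where
  "zero_in_resolvent D A \<longleftrightarrow> bij_betw A D UNIV \<and> (\<exists>C. \<forall>x\<in>D. norm x \<le> C * norm (A x))"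

definition orth_proj :: "('a::chilbert_space \<Rightarrow> 'a) \<Rightarrow> bool" where
  "orth_proj P \<longleftrightarrow> (\<forall>x y. P (x + y) = P x + P y) \<and> (\<forall>c x. P (c *\<^sub>C x) = c *\<^sub>C P x) \<and>
     (\<forall>x. P (P x) = P x) \<and> (\<forall>x y. cinner (P x) y = cinner x (P y))"

text \<open>The scalar measure B \<mapsto> \<langle>E(B)x,x\<rangle> = \<parallel>E(B)x\<parallel>^2 on the Borel sets of the line.\<close>
definition spectral_scalar :: "(real set \<Rightarrow> 'a::chilbert_space \<Rightarrow> 'a) \<Rightarrow> 'a \<Rightarrow> real measure" where
  "spectral_scalar E x = measure_of UNIV (sets borel) (\<lambda>B. ennreal ((norm (E B x))\<^sup>2))"

text \<open>E is the spectral measure of the self-adjoint operator (D, A):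
a projection valued measure on the Borel sets with E(\<real>) = I, multiplicative,
strongly countably additive, and A = \<integral> \<mu> dE(\<mu>), i.e.
dom A = {x. \<integral> \<mu>^2 d\<langle>E(\<mu>)x,x\<rangle> < \<infinity>} and
\<langle>Ax,x\<rangle> = \<integral> \<mu> d\<langle>E(\<mu>)x,x\<rangle> on dom A (by polarization this determines
\<langle>Ax,y\<rangle>).\<close>
definition spectral_measure ::
  "'a::chilbert_space set \<Rightarrow> ('a \<Rightarrow> 'a) \<Rightarrow> (real set \<Rightarrow> 'a \<Rightarrow> 'a) \<Rightarrow> bool" where
  "spectral_measure D A E \<longleftrightarrow>
     (\<forall>B\<in>sets borel. orth_proj (E B)) \<and>
     E UNIV = id \<and>
     (\<forall>B\<in>sets borel. \<forall>C\<in>sets borel. E (B \<inter> C) = E B \<circ> E C) \<and>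
     (\<forall>F x. range F \<subseteq> sets borel \<longrightarrow> disjoint_family F \<longrightarrow>
        (\<lambda>n. \<Sum>i<n. E (F i) x) \<longlonglongrightarrow> E (\<Union>i. F i) x) \<and>
     D = {x. (\<integral>\<^sup>+ \<mu>. ennreal (\<mu>\<^sup>2) \<partial>spectral_scalar E x) < \<infinity>} \<and>
     (\<forall>x\<in>D. cinner (A x) x = complex_of_real (\<integral> \<mu>. \<mu> \<partial>spectral_scalar E x))"

text \<open>The (unique) spectral measure of a self-adjoint operator.\<close>
definition spec_meas :: "'a::chilbert_space set \<Rightarrow> ('a \<Rightarrow> 'a) \<Rightarrow> real set \<Rightarrow> 'a \<Rightarrow> 'a" where
  "spec_meas D A = (SOME E. spectral_measure D A E)"

text \<open>Form domain dom \<aa> = dom |A|^(1/2) = {x. \<integral> |\<mu>| d\<langle>E(\<mu>)x,x\<rangle> < \<infinity>}.\<close>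
definition form_dom :: "'a::chilbert_space set \<Rightarrow> ('a \<Rightarrow> 'a) \<Rightarrow> 'a set" where
  "form_dom D A = {x. (\<integral>\<^sup>+ \<mu>. ennreal \<bar>\<mu>\<bar> \<partial>spectral_scalar (spec_meas D A) x) < \<infinity>}"

definition form :: "'a::chilbert_space set \<Rightarrow> ('a \<Rightarrow> 'a) \<Rightarrow> 'a \<Rightarrow> real" where
  "form D A x = (\<integral> \<mu>. \<mu> \<partial>spectral_scalar (spec_meas D A) x)"

definition max_nonneg_subspaces :: "'a::complex_vector set \<Rightarrow> ('a \<Rightarrow> real) \<Rightarrow> 'a set set" where
  "max_nonneg_subspaces \<D> q =
     {L. csubspace L \<and> L \<subseteq> \<D> \<and> (\<forall>x\<in>L. q x \<ge> 0) \<and>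
         (\<forall>L'. csubspace L' \<and> L' \<subseteq> \<D> \<and> (\<forall>x\<in>L'. q x \<ge> 0) \<and> L \<subseteq> L' \<longrightarrow> L' = L)}"

end

theory Submission
  imports Defs
begin

text \<open>
  If \<open>0\<close> belonged to the spectrum of \<open>T(\<mu>\<^sub>2)\<close>, there would be unit vectors \<open>v\<close> in its domain with
  \<open>T(\<mu>\<^sub>2) v\<close> arbitrarily small. Adding such a \<open>v\<close> to \<open>\<M>\<close> changes the form \<open>t(\<mu>\<^sub>2)\<close> only slightly, so
  \<open>t(\<mu>\<^sub>2)[u] \<ge> - 4 \<eta> \<parallel>u\<parallel>\<^sup>2\<close> on \<open>\<M> + span v\<close> with \<open>\<eta>\<close> small. By (VM), a unit vector with
  \<open>t(\<mu>\<^sub>1)[u] < 0\<close> has \<open>t(\<mu>\<^sub>2)[u]\<close> below a fixed negative number, hence \<open>t(\<mu>\<^sub>1) \<ge> 0\<close> on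
  \<open>\<M> + span v\<close>. Maximality forces \<open>v \<in> \<M>\<close>, contradicting \<open>t(\<mu>\<^sub>2)[v] \<ge> a\<close>.

  The form is defined through a chosen spectral measure, so the argument rests on the spectral
  theorem for unbounded self-adjoint operators. The scalar spectral measures of the Cayley transform
  are obtained as weak limits of Fejer densities (Herglotz), and all algebraic identities
  for the resulting functional calculus follow from the fact that a \<open>\<sigma>\<close>-continuous linear functional on
  bounded Borel functions is determined by its values on the integer powers of
  \<open>(s - \<i>) / (s + \<i>)\<close>.
\<close>

section \<open>Complex inner product spaces\<close>

lemma scaleC_zero_left [simp]: "0 *\<^sub>C x = (0::'a::complex_vector)"
  using scaleC_add_left[of 0 0 x] by simp

lemma scaleC_zero_right [simp]: "c *\<^sub>C 0 = (0::'a::complex_vector)"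
  using scaleC_add_right[of c 0 0] by simp

lemma scaleC_minus_left: "(- c) *\<^sub>C x = - (c *\<^sub>C (x::'a::complex_vector))"
  by (metis add_eq_0_iff add.right_inverse scaleC_add_left scaleC_zero_left)

lemma scaleC_minus_right: "c *\<^sub>C (- x) = - (c *\<^sub>C (x::'a::complex_vector))"
  by (metis add_eq_0_iff add.right_inverse scaleC_add_right scaleC_zero_right)

lemma scaleC_diff_right: "c *\<^sub>C (x - y) = c *\<^sub>C x - c *\<^sub>C (y::'a::complex_vector)"
  using scaleC_add_right[of c x "- y"] by (simp add: scaleC_minus_right)

lemma minus_eq_scaleC: "- x = (- 1) *\<^sub>C (x::'a::complex_vector)"
  by (simp add: scaleC_minus_left scaleC_one)

lemma scaleC_double: "(2 * c) *\<^sub>C x = c *\<^sub>C x + c *\<^sub>C (x::'a::complex_vector)"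
  using scaleC_add_left[of c c x] by simp

lemma cinner_add_right: "cinner x (y + z) = cinner x y + cinner (x::'a::complex_inner) z"
  by (metis cinner_conj_commute cinner_add_left complex_cnj_add)

lemma cinner_scaleC_right: "cinner x (c *\<^sub>C y) = cnj c * cinner (x::'a::complex_inner) y"
  by (metis cinner_conj_commute cinner_scaleC_left complex_cnj_mult)

lemma cinner_zero_left [simp]: "cinner 0 (x::'a::complex_inner) = 0"
  using cinner_add_left[of 0 0 x] by simp

lemma cinner_zero_right [simp]: "cinner (x::'a::complex_inner) 0 = 0"
  using cinner_add_right[of x 0 0] by simp

lemma cinner_minus_left: "cinner (- x) (y::'a::complex_inner) = - cinner x y"
  using cinner_scaleC_left[of "-1" x y] by (simp add: scaleC_minus_left scaleC_one)

lemma cinner_minus_right: "cinner x (- y::'a::complex_inner) = - cinner x y"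
  using cinner_scaleC_right[of x "-1" y] by (simp add: scaleC_minus_left scaleC_one)

lemma cinner_diff_left: "cinner (x - y) (z::'a::complex_inner) = cinner x z - cinner y z"
  using cinner_add_left[of x "- y" z] by (simp add: cinner_minus_left)

lemma cinner_diff_right: "cinner x (y - z::'a::complex_inner) = cinner x y - cinner x z"
  using cinner_add_right[of x y "- z"] by (simp add: cinner_minus_right)

lemmas cinner_simps = cinner_add_left cinner_add_right cinner_diff_left cinner_diff_right
  cinner_scaleC_left cinner_scaleC_right cinner_minus_left cinner_minus_right

lemma cinner_sum_left: "cinner (\<Sum>i\<in>I. f i) (y::'a::complex_inner) = (\<Sum>i\<in>I. cinner (f i) y)"
  by (induction I rule: infinite_finite_induct) (auto simp: cinner_add_left)

lemma cinner_sum_right: "cinner (y::'a::complex_inner) (\<Sum>i\<in>I. f i) = (\<Sum>i\<in>I. cinner y (f i))"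
  by (induction I rule: infinite_finite_induct) (auto simp: cinner_add_right)

lemma Re_cinner_commute: "Re (cinner x y) = Re (cinner y (x::'a::complex_inner))"
  by (metis cinner_conj_commute cnj.simps(1))

lemma cinner_self: "cinner x x = complex_of_real ((norm (x::'a::complex_inner))\<^sup>2)"
  by (simp add: norm_eq_sqrt_cinner cinner_self_nonneg complex_eq_iff cinner_self_real)

lemma norm_sq_eq_cinner: "(norm (x::'a::complex_inner))\<^sup>2 = Re (cinner x x)"
  by (simp add: cinner_self)

lemma norm_scaleC: "norm (c *\<^sub>C x) = cmod c * norm (x::'a::complex_inner)"
proof -
  have "(norm (c *\<^sub>C x))\<^sup>2 = Re ((c * cnj c) * cinner x x)"
    by (simp add: norm_sq_eq_cinner cinner_simps mult_ac)
  also have "\<dots> = (cmod c * norm x)\<^sup>2"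
    by (simp add: complex_norm_square[symmetric] cinner_self power_mult_distrib del: of_real_power)
  finally show ?thesis by (simp add: power2_eq_iff_nonneg)
qed

lemma norm_sq_add: "(norm (x + y))\<^sup>2 = (norm x)\<^sup>2 + 2 * Re (cinner x y) + (norm (y::'a::complex_inner))\<^sup>2"
  using Re_cinner_commute[of x y] by (simp add: norm_sq_eq_cinner cinner_simps)

lemma parallelogram_law:
  "(norm (x + y))\<^sup>2 + (norm (x - y))\<^sup>2 = 2 * (norm x)\<^sup>2 + 2 * (norm (y::'a::complex_inner))\<^sup>2"
  using norm_sq_add[of x y] norm_sq_add[of x "- y"] by (simp add: cinner_simps)

lemma norm_cinner_le: "cmod (cinner x y) \<le> norm x * norm (y::'a::complex_inner)"
proof (cases "y = 0")
  case False
  define c where "c = cinner x y / complex_of_real ((norm y)\<^sup>2)"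
  have pos: "norm y > 0" using False by simp
  have "cinner (x - c *\<^sub>C y) y = 0"
    using pos by (simp add: cinner_simps c_def cinner_self)
  then have "(norm ((x - c *\<^sub>C y) + c *\<^sub>C y))\<^sup>2 = (norm (x - c *\<^sub>C y))\<^sup>2 + (norm (c *\<^sub>C y))\<^sup>2"
    by (subst norm_sq_add) (simp add: cinner_simps)
  then have "(norm (c *\<^sub>C y))\<^sup>2 \<le> (norm x)\<^sup>2" by simp
  then have "cmod c * norm y \<le> norm x" by (simp add: norm_scaleC power2_le_iff_abs_le)
  moreover have "cmod c = cmod (cinner x y) / (norm y)\<^sup>2"
    by (simp add: c_def norm_divide norm_power)
  ultimately show ?thesis using pos by (simp add: field_simps power2_eq_square)
qed simp

lemma abs_Re_cinner_le: "\<bar>Re (cinner x y)\<bar> \<le> norm x * norm (y::'a::complex_inner)"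
  using abs_Re_le_cmod norm_cinner_le order_trans by blast

lemma bounded_linear_cinner_left: "bounded_linear (\<lambda>x. cinner x (y::'a::complex_inner))"
  by (rule bounded_linear_intro[where K = "norm y"])
     (auto simp: cinner_simps scaleR_scaleC scaleR_conv_of_real norm_cinner_le)

lemma bounded_linear_cinner_right: "bounded_linear (\<lambda>x. cinner (y::'a::complex_inner) x)"
  by (rule bounded_linear_intro[where K = "norm y"])
     (auto simp: cinner_simps scaleR_scaleC scaleR_conv_of_real norm_cinner_le mult.commute[of _ "norm y"])

lemmas tendsto_cinner_left = bounded_linear.tendsto[OF bounded_linear_cinner_left]
lemmas tendsto_cinner_right = bounded_linear.tendsto[OF bounded_linear_cinner_right]

lemma cinner_ext_left:
  assumes "\<And>x. cinner y x = cinner (z::'a::complex_inner) x"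
  shows "y = z"
proof -
  have "cinner (y - z) (y - z) = 0" using assms[of "y - z"] by (simp add: cinner_diff_left)
  then show ?thesis by (simp add: cinner_self_eq_zero)
qed

lemma sgn_eq_scaleC: "sgn x = complex_of_real (inverse (norm x)) *\<^sub>C (x::'a::complex_inner)"
  by (simp only: sgn_div_norm scaleR_scaleC)

lemma scaleC_norm_sgn: "complex_of_real (norm x) *\<^sub>C sgn x = (x::'a::complex_inner)"
  by (cases "x = 0") (simp_all add: sgn_div_norm flip: scaleR_scaleC)

lemma tendsto_if_norm_diff_sq_tendsto_0:
  fixes f :: "'b \<Rightarrow> 'a::real_normed_vector"
  assumes "((\<lambda>i. (norm (f i - l))\<^sup>2) \<longlongrightarrow> 0) F"
  shows "(f \<longlongrightarrow> l) F"
proof -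
  have "((\<lambda>i. norm (f i - l)) \<longlongrightarrow> 0) F" using tendsto_real_sqrt[OF assms] by simp
  then show ?thesis using LIM_zero_cancel tendsto_norm_zero_iff by blast
qed

lemma csubspaceD:
  assumes "csubspace S"
  shows csubspace_zero: "0 \<in> S"
    and csubspace_add: "x \<in> S \<Longrightarrow> y \<in> S \<Longrightarrow> x + y \<in> S"
    and csubspace_scaleC: "x \<in> S \<Longrightarrow> c *\<^sub>C x \<in> S"
    and csubspace_minus: "x \<in> S \<Longrightarrow> - x \<in> S"
    and csubspace_diff: "x \<in> S \<Longrightarrow> y \<in> S \<Longrightarrow> x - y \<in> S"
proof -
  show zero: "0 \<in> S" and add: "x \<in> S \<Longrightarrow> y \<in> S \<Longrightarrow> x + y \<in> S" and scaleC: "x \<in> S \<Longrightarrow> c *\<^sub>C x \<in> S" for x y c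
    using assms by (auto simp: csubspace_def)
  show minus: "x \<in> S \<Longrightarrow> - x \<in> S" for x using scaleC[of x "-1"] by (simp add: minus_eq_scaleC)
  show "x \<in> S \<Longrightarrow> y \<in> S \<Longrightarrow> x - y \<in> S" using add[of x "- y"] minus by simp
qed

lemma csubspace_UNIV: "csubspace UNIV"
  by (simp add: csubspace_def)

lemma csubspace_image:
  assumes S: "csubspace S"
    and add: "\<And>x y. x \<in> S \<Longrightarrow> y \<in> S \<Longrightarrow> f (x + y) = f x + f y"
    and scaleC: "\<And>c x. x \<in> S \<Longrightarrow> f (c *\<^sub>C x) = c *\<^sub>C f x"
  shows "csubspace (f ` S)"
  unfolding csubspace_def
proof (intro conjI ballI allI)
  show "0 \<in> f ` S"
    using scaleC[OF csubspace_zero[OF S], of 0] csubspace_zero[OF S] by (metis imageI scaleC_zero_left)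
  show "u + v \<in> f ` S" if "u \<in> f ` S" "v \<in> f ` S" for u v
    using that csubspace_add[OF S] by (auto simp flip: add)
  show "c *\<^sub>C u \<in> f ` S" if "u \<in> f ` S" for c u
    using that csubspace_scaleC[OF S] by (auto simp flip: scaleC)
qed

lemma csubspace_plus_line:
  assumes S: "csubspace S" shows "csubspace {x + c *\<^sub>C v |x c. x \<in> S}"
  unfolding csubspace_def
proof (intro conjI ballI allI)
  let ?L = "{x + c *\<^sub>C v |x c. x \<in> S}"
  have mem: "x + c *\<^sub>C v \<in> ?L" if "x \<in> S" for x c using that by blast
  show "0 \<in> ?L" using mem[OF csubspace_zero[OF S], of 0] by simp
  fix u assume "u \<in> ?L"
  then obtain x c where u: "u = x + c *\<^sub>C v" "x \<in> S" by blast
  show "k *\<^sub>C u \<in> ?L" for k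
    using mem[OF csubspace_scaleC[OF S u(2)], of k "k * c"]
    by (simp add: u(1) scaleC_add_right scaleC_scaleC)
  fix w assume "w \<in> ?L"
  then obtain y d where w: "w = y + d *\<^sub>C v" "y \<in> S" by blast
  show "u + w \<in> ?L"
    using mem[OF csubspace_add[OF S u(2) w(2)], of "c + d"]
    by (simp add: u(1) w(1) scaleC_add_left add_ac)
qed

section \<open>The Riesz representation theorem\<close>

locale bounded_functional_on =
  fixes S :: "'a::chilbert_space set" and \<phi> :: "'a \<Rightarrow> complex" and C :: real
  assumes subspace: "csubspace S"
    and add: "\<And>x y. x \<in> S \<Longrightarrow> y \<in> S \<Longrightarrow> \<phi> (x + y) = \<phi> x + \<phi> y"
    and scaleC: "\<And>c x. x \<in> S \<Longrightarrow> \<phi> (c *\<^sub>C x) = c * \<phi> x"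
    and bound: "\<And>x. x \<in> S \<Longrightarrow> cmod (\<phi> x) \<le> C * norm x"
begin

definition energy :: "'a \<Rightarrow> real" where
  "energy u = (norm u)\<^sup>2 - 2 * Re (\<phi> u)"

definition min_energy :: real where
  "min_energy = Inf (energy ` S)"

lemma bdd_below_energy: "bdd_below (energy ` S)"
proof (rule bdd_belowI2)
  fix u assume "u \<in> S"
  then have "Re (\<phi> u) \<le> C * norm u"
    using bound complex_Re_le_cmod order_trans by blast
  moreover have "(norm u - C)\<^sup>2 \<ge> 0" by simp
  ultimately show "- C\<^sup>2 \<le> energy u" unfolding energy_def by (simp add: power2_diff algebra_simps)
qed

lemma min_energy_le: "u \<in> S \<Longrightarrow> min_energy \<le> energy u"
  unfolding min_energy_def using bdd_below_energy by (auto intro: cInf_lower)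

lemma minimizing_sequence_exists:
  obtains u where "\<And>n. u n \<in> S" "(\<lambda>n. energy (u n)) \<longlonglongrightarrow> min_energy"
proof -
  have "min_energy \<in> closure (energy ` S)"
    unfolding min_energy_def using csubspace_zero[OF subspace]
    by (intro closure_contains_Inf bdd_below_energy) auto
  then obtain e where e: "\<And>n. e n \<in> energy ` S" "e \<longlonglongrightarrow> min_energy"
    by (auto simp: closure_sequential)
  then obtain u where u: "\<And>n. u n \<in> S" "\<And>n. energy (u n) = e n" unfolding image_iff by metis
  show ?thesis by (rule that[of u]) (simp_all add: u e)
qed

lemma norm_diff_sq_le_energy:
  assumes v: "v \<in> S" and w: "w \<in> S"
  shows "(norm (v - w))\<^sup>2 \<le> 2 * (energy v - min_energy) + 2 * (energy w - min_energy)"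
proof -
  define h where "h = (1/2) *\<^sub>C (v + w)"
  have h: "h \<in> S" using csubspaceD[OF subspace] v w by (simp add: h_def)
  have "\<phi> h = (\<phi> v + \<phi> w) / 2"
    using csubspaceD[OF subspace] v w by (simp add: h_def scaleC add)
  then have "Re (\<phi> h) = (Re (\<phi> v) + Re (\<phi> w)) / 2"
    by (metis Re_divide_numeral plus_complex.simps(1))
  moreover have "4 * (norm h)\<^sup>2 = (norm (v + w))\<^sup>2"
    by (simp add: h_def norm_scaleC power_mult_distrib power2_eq_square)
  ultimately show ?thesis
    using parallelogram_law[of v w] min_energy_le[OF h] unfolding energy_def by simp
qed

lemma minimizing_sequence_Cauchy:
  assumes u: "\<And>n. u n \<in> S" and lim: "(\<lambda>n. energy (u n)) \<longlonglongrightarrow> min_energy"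
  shows "Cauchy u"
proof (rule CauchyI)
  fix e :: real assume e: "e > 0"
  then have "\<forall>\<^sub>F n in sequentially. energy (u n) < min_energy + e\<^sup>2 / 4"
    by (intro order_tendstoD(2)[OF lim]) simp
  then obtain N where N: "\<And>n. n \<ge> N \<Longrightarrow> energy (u n) < min_energy + e\<^sup>2 / 4"
    unfolding eventually_sequentially by blast
  show "\<exists>N. \<forall>k\<ge>N. \<forall>l\<ge>N. norm (u k - u l) < e"
  proof (intro exI allI impI)
    fix k l assume "k \<ge> N" "l \<ge> N"
    then have "(norm (u k - u l))\<^sup>2 < e\<^sup>2"
      using norm_diff_sq_le_energy[OF u u, of k l] N[of k] N[of l] by simp
    then show "norm (u k - u l) < e" using e power2_less_imp_less[of _ e] by simp
  qed
qed

lemma Re_eq_cinner_limit_of_minimizing_sequence: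
  assumes u: "\<And>n. u n \<in> S" and lim: "(\<lambda>n. energy (u n)) \<longlonglongrightarrow> min_energy" and y: "u \<longlonglongrightarrow> y"
    and x: "x \<in> S"
  shows "Re (\<phi> x) = Re (cinner x y)"
proof -
  have variation: "0 \<le> (norm z)\<^sup>2 + 2 * Re (cinner y z) - 2 * Re (\<phi> z)" if z: "z \<in> S" for z
  proof (rule LIMSEQ_le_const)
    let ?d = "\<lambda>n. energy (u n) - min_energy + ((norm z)\<^sup>2 + 2 * Re (cinner (u n) z) - 2 * Re (\<phi> z))"
    show "?d \<longlonglongrightarrow> (norm z)\<^sup>2 + 2 * Re (cinner y z) - 2 * Re (\<phi> z)"
      using tendsto_diff[OF lim tendsto_const[of min_energy]]
      by (intro tendsto_add[where a = 0, simplified] tendsto_intros tendsto_cinner_left y) simp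
    have "0 \<le> ?d n" for n
      using min_energy_le[OF csubspace_add[OF subspace u z], of n]
      by (simp add: energy_def add u z norm_sq_add)
    then show "\<exists>N. \<forall>n\<ge>N. 0 \<le> ?d n" by blast
  qed
  define d where "d = Re (\<phi> x) - Re (cinner y x)"
  define r where "r = d / ((norm x)\<^sup>2 + 1)"
  have pos: "(norm x)\<^sup>2 + 1 > 0" by (simp add: add_nonneg_pos)
  have "0 \<le> r\<^sup>2 * (norm x)\<^sup>2 - 2 * (r * d)"
    using variation[of "complex_of_real r *\<^sub>C x"] csubspace_scaleC[OF subspace x]
    by (simp add: scaleC x norm_scaleC cinner_simps power_mult_distrib d_def algebra_simps)
  also have "\<dots> = - (r\<^sup>2 * ((norm x)\<^sup>2 + 2))"
  proof -
    have "d = r * ((norm x)\<^sup>2 + 1)" using pos by (simp add: r_def)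
    then show ?thesis by (simp add: algebra_simps power2_eq_square)
  qed
  finally have "r\<^sup>2 * ((norm x)\<^sup>2 + 2) \<le> 0" by simp
  moreover have "(norm x)\<^sup>2 + 2 > 0" by (simp add: add_nonneg_pos)
  ultimately have "r = 0" by (simp add: mult_le_0_iff)
  then have "d = 0" using pos by (simp add: r_def)
  then show ?thesis by (simp add: d_def Re_cinner_commute)
qed

theorem riesz_representation: "\<exists>y. \<forall>x\<in>S. \<phi> x = cinner x y"
proof -
  obtain u where u: "\<And>n. u n \<in> S" "(\<lambda>n. energy (u n)) \<longlonglongrightarrow> min_energy"
    using minimizing_sequence_exists by blast
  then obtain y where y: "u \<longlonglongrightarrow> y"
    using minimizing_sequence_Cauchy Cauchy_convergent_iff convergent_def by blast
  note Re_eq = Re_eq_cinner_limit_of_minimizing_sequence[OF u y]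
  have "\<phi> x = cinner x y" if x: "x \<in> S" for x
    using Re_eq[OF x] Re_eq[of "\<i> *\<^sub>C x"] csubspace_scaleC[OF subspace x, of "\<i>"]
    by (simp add: scaleC x cinner_simps complex_eq_iff)
  then show ?thesis by blast
qed

end

corollary riesz_representation_operator:
  fixes A :: "'a::complex_vector \<Rightarrow> 'b::chilbert_space"
  assumes D: "csubspace D"
    and A_add: "\<And>x y. x \<in> D \<Longrightarrow> y \<in> D \<Longrightarrow> A (x + y) = A x + A y"
    and A_scaleC: "\<And>c x. x \<in> D \<Longrightarrow> A (c *\<^sub>C x) = c *\<^sub>C A x"
    and \<phi>_add: "\<And>x y. x \<in> D \<Longrightarrow> y \<in> D \<Longrightarrow> \<phi> (x + y) = \<phi> x + \<phi> y"
    and \<phi>_scaleC: "\<And>c x. x \<in> D \<Longrightarrow> \<phi> (c *\<^sub>C x) = c * \<phi> x"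
    and bound: "\<And>x. x \<in> D \<Longrightarrow> cmod (\<phi> x) \<le> C * norm (A x)"
  shows "\<exists>y. \<forall>x\<in>D. \<phi> x = cinner (A x) y"
proof -
  define \<psi> where "\<psi> = \<phi> \<circ> inv_into D A"
  have \<psi>_A: "\<psi> (A x) = \<phi> x" if x: "x \<in> D" for x
  proof -
    define x' where "x' = inv_into D A (A x)"
    have x': "x' \<in> D" "A x' = A x" using x by (auto simp: x'_def inv_into_into f_inv_into_f)
    define d where "d = x' + (- 1) *\<^sub>C x"
    have d: "d \<in> D" "A d = A x' + (- 1) *\<^sub>C A x" "\<phi> d = \<phi> x' + (- 1) * \<phi> x"
      using csubspace_add[OF D] csubspace_scaleC[OF D] x x'(1)
      by (simp_all only: d_def A_add A_scaleC \<phi>_add \<phi>_scaleC)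
    then have "\<phi> x' = \<phi> x" using bound[OF d(1)] x'(2) by (simp add: scaleC_minus_left scaleC_one)
    then show ?thesis by (simp add: \<psi>_def x'_def)
  qed
  interpret bounded_functional_on "A ` D" \<psi> C
  proof
    show "csubspace (A ` D)" by (intro csubspace_image D A_add A_scaleC)
    show "\<psi> (u + v) = \<psi> u + \<psi> v" if "u \<in> A ` D" "v \<in> A ` D" for u v
      using that csubspace_add[OF D] by (auto simp: \<psi>_A \<phi>_add simp flip: A_add)
    show "\<psi> (c *\<^sub>C u) = c * \<psi> u" if "u \<in> A ` D" for c u
      using that csubspace_scaleC[OF D] by (auto simp: \<psi>_A \<phi>_scaleC simp flip: A_scaleC)
    show "cmod (\<psi> u) \<le> C * norm u" if "u \<in> A ` D" for u
      using that bound by (auto simp: \<psi>_A)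
  qed
  show ?thesis using riesz_representation \<psi>_A by auto
qed

section \<open>Self-adjoint operators and the Cayley transform\<close>

locale self_adjoint_operator =
  fixes D :: "'a::chilbert_space set" and A :: "'a \<Rightarrow> 'a"
  assumes self_adj: "self_adjoint D A"
begin

lemma csubspace_dom: "csubspace D"
  and dense_dom: "closure D = UNIV"
  and A_add: "x \<in> D \<Longrightarrow> y \<in> D \<Longrightarrow> A (x + y) = A x + A y"
  and A_scaleC: "x \<in> D \<Longrightarrow> A (c *\<^sub>C x) = c *\<^sub>C A x"
  and A_sym: "x \<in> D \<Longrightarrow> y \<in> D \<Longrightarrow> cinner (A x) y = cinner x (A y)"
  and adjoint_memD: "(\<And>x. x \<in> D \<Longrightarrow> cinner (A x) y = cinner x z) \<Longrightarrow> y \<in> D \<and> z = A y"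
  using self_adj unfolding self_adjoint_def by blast+

lemmas zero_dom = csubspace_zero[OF csubspace_dom]
  and add_dom = csubspace_add[OF csubspace_dom]
  and scaleC_dom = csubspace_scaleC[OF csubspace_dom]
  and minus_dom = csubspace_minus[OF csubspace_dom]
  and diff_dom = csubspace_diff[OF csubspace_dom]

lemma A_minus: "x \<in> D \<Longrightarrow> A (- x) = - A x"
  using A_scaleC[of x "-1"] by (simp add: scaleC_minus_left scaleC_one)

lemma A_diff: "x \<in> D \<Longrightarrow> y \<in> D \<Longrightarrow> A (x - y) = A x - A y"
  using A_add[of x "- y"] minus_dom[of y] by (simp add: A_minus)

lemma zero_in_resolvent_if_bounded_below:
  assumes le: "\<And>x. x \<in> D \<Longrightarrow> norm x \<le> C * norm (A x)"
  shows "zero_in_resolvent D A"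
proof -
  have "inj_on A D"
  proof (rule inj_onI)
    fix x y assume "x \<in> D" "y \<in> D" "A x = A y"
    then show "x = y" using le[of "x - y"] diff_dom by (simp add: A_diff)
  qed
  moreover have "z \<in> A ` D" for z
  proof -
    have "\<exists>y. \<forall>x\<in>D. cinner x z = cinner (A x) y"
    proof (rule riesz_representation_operator[where C = "C * norm z"])
      fix x assume x: "x \<in> D"
      have "cmod (cinner x z) \<le> norm x * norm z" by (rule norm_cinner_le)
      also have "\<dots> \<le> (C * norm (A x)) * norm z" using le[OF x] by (intro mult_right_mono) auto
      finally show "cmod (cinner x z) \<le> C * norm z * norm (A x)" by (simp add: mult_ac)
    qed (auto simp: csubspace_dom A_add A_scaleC cinner_simps)
    then obtain y where "\<And>x. x \<in> D \<Longrightarrow> cinner (A x) y = cinner x z" by metis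
    then show ?thesis using adjoint_memD by blast
  qed
  ultimately show ?thesis unfolding zero_in_resolvent_def bij_betw_def using le by auto
qed

lemma approximate_kernel_if_not_resolvent:
  assumes not_resolvent: "\<not> zero_in_resolvent D A" and \<eta>: "\<eta> > 0"
  obtains x where "x \<in> D" "norm x = 1" "norm (A x) < \<eta>"
proof -
  have "\<exists>z\<in>D. \<not> norm z \<le> (1 / \<eta>) * norm (A z)"
    using zero_in_resolvent_if_bounded_below not_resolvent by blast
  then obtain z where z: "z \<in> D" "norm (A z) < \<eta> * norm z"
    using \<eta> by (auto simp: field_simps not_le)
  then have pos: "norm z > 0" by (cases "z = 0") (auto simp: not_less)
  show ?thesis
  proof
    show "sgn z \<in> D" using scaleC_dom z by (simp add: sgn_eq_scaleC)
    show "norm (sgn z) = 1" using pos by (simp add: norm_sgn)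
    show "norm (A (sgn z)) < \<eta>"
      using pos z
      by (simp add: sgn_eq_scaleC A_scaleC norm_scaleC norm_inverse norm_divide field_simps)
  qed
qed

lemma mem_dom_if_limit_with_bounded_images:
  assumes x: "\<And>n. x n \<in> D" "x \<longlonglongrightarrow> y" and le: "\<And>n. norm (A (x n)) \<le> K"
  shows "y \<in> D"
proof -
  have "\<exists>z. \<forall>u\<in>D. cinner (A u) y = cinner (id u) z"
  proof (rule riesz_representation_operator[where C = K])
    fix u assume u: "u \<in> D"
    have "cmod (cinner (A u) (x n)) \<le> K * norm (id u)" for n
      using norm_cinner_le[of u "A (x n)"] mult_left_mono[OF le[of n] norm_ge_zero[of u]]
      by (simp add: A_sym[OF u x(1)] mult.commute)
    then show "cmod (cinner (A u) y) \<le> K * norm (id u)"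
      by (intro Lim_bounded[OF tendsto_norm[OF tendsto_cinner_right[OF x(2)]]]) blast
  qed (auto simp: csubspace_dom A_add A_scaleC cinner_simps)
  then show ?thesis using adjoint_memD by auto
qed

lemma norm_sq_imaginary_shift:
  assumes c: "Re c = 0" and x: "x \<in> D"
  shows "(norm (A x + c *\<^sub>C x))\<^sup>2 = (norm (A x))\<^sup>2 + (cmod c)\<^sup>2 * (norm x)\<^sup>2"
proof -
  have "cinner (A x) x = cnj (cinner (A x) x)"
    using A_sym[OF x x] cinner_conj_commute by metis
  then have "Im (cinner (A x) x) = 0" by (metis cnj.simps(2) neg_equal_zero)
  then show ?thesis
    by (simp add: norm_sq_add norm_scaleC power_mult_distrib cinner_simps c)
qed

lemma norm_le_imaginary_shift:
  assumes "Re c = 0" "x \<in> D"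
  shows "cmod c * norm x \<le> norm (A x + c *\<^sub>C x)"
  by (rule power2_le_imp_le) (simp_all add: norm_sq_imaginary_shift[OF assms] power_mult_distrib)

lemma imaginary_shift_bij:
  assumes c: "Re c = 0" "c \<noteq> 0"
  shows "\<exists>!x. x \<in> D \<and> A x + c *\<^sub>C x = z"
proof -
  have cnj: "cnj c = - c" using c by (simp add: complex_eq_iff)
  have "\<exists>y. \<forall>x\<in>D. cinner x z = cinner (A x + cnj c *\<^sub>C x) y"
  proof (rule riesz_representation_operator[where C = "norm z / cmod c"])
    fix x assume x: "x \<in> D"
    have "cmod c * cmod (cinner x z) \<le> (cmod c * norm x) * norm z"
      using mult_left_mono[OF norm_cinner_le[of x z], of "cmod c"] by (simp add: mult.assoc)
    also have "\<dots> \<le> norm (A x + cnj c *\<^sub>C x) * norm z"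
      using norm_le_imaginary_shift[of "cnj c" x] c x by (intro mult_right_mono) auto
    finally show "cmod (cinner x z) \<le> norm z / cmod c * norm (A x + cnj c *\<^sub>C x)"
      using c by (simp add: field_simps)
  qed (auto simp: csubspace_dom A_add A_scaleC cinner_simps scaleC_add_right scaleC_scaleC mult_ac)
  then obtain y where y: "\<And>x. x \<in> D \<Longrightarrow> cinner x z = cinner (A x + cnj c *\<^sub>C x) y" by blast
  have "cinner (A x) y = cinner x (z - c *\<^sub>C y)" if "x \<in> D" for x
    using y[OF that] by (simp add: cinner_simps)
  then have sol: "y \<in> D" "A y + c *\<^sub>C y = z"
    using adjoint_memD[of y "z - c *\<^sub>C y"] by (auto simp: algebra_simps)
  moreover have "x = y" if x: "x \<in> D" "A x + c *\<^sub>C x = z" for x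
  proof -
    have "A (x - y) + c *\<^sub>C (x - y) = 0"
      using x sol by (simp add: A_diff scaleC_diff_right algebra_simps)
    then show ?thesis
      using norm_le_imaginary_shift[OF c(1) diff_dom[OF x(1) sol(1)]] c by (simp add: mult_le_0_iff)
  qed
  ultimately show ?thesis by blast
qed

definition shift_inv :: "complex \<Rightarrow> 'a \<Rightarrow> 'a" where
  "shift_inv c z = (THE x. x \<in> D \<and> A x + c *\<^sub>C x = z)"

definition cayley_transform :: "complex \<Rightarrow> 'a \<Rightarrow> 'a" where
  "cayley_transform c z = z - (2 * c) *\<^sub>C shift_inv c z"

context
  fixes c :: complex
  assumes c: "Re c = 0" "c \<noteq> 0"
begin

lemma shift_inv_dom: "shift_inv c z \<in> D"
  and shift_shift_inv: "A (shift_inv c z) + c *\<^sub>C shift_inv c z = z"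
  using theI'[OF imaginary_shift_bij[OF c, of z]] by (simp_all add: shift_inv_def)

lemma shift_inv_shift: "x \<in> D \<Longrightarrow> shift_inv c (A x + c *\<^sub>C x) = x"
  unfolding shift_inv_def using imaginary_shift_bij[OF c] by (intro the1_equality) auto

lemma cayley_transform_shift: "x \<in> D \<Longrightarrow> cayley_transform c (A x + c *\<^sub>C x) = A x - c *\<^sub>C x"
  by (simp add: cayley_transform_def shift_inv_shift scaleC_double)

lemma shift_decomposition:
  obtains x where "x \<in> D" "z = A x + c *\<^sub>C x"
  using shift_inv_dom shift_shift_inv that by metis

lemma cayley_transform_add: "cayley_transform c (y + z) = cayley_transform c y + cayley_transform c z"
proof -
  obtain u v where uv: "u \<in> D" "y = A u + c *\<^sub>C u" "v \<in> D" "z = A v + c *\<^sub>C v"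
    using shift_decomposition by metis
  then have "y + z = A (u + v) + c *\<^sub>C (u + v)" by (simp add: A_add scaleC_add_right)
  then show ?thesis
    using uv add_dom by (simp only: cayley_transform_shift) (simp add: A_add scaleC_add_right)
qed

lemma cayley_transform_scaleC: "cayley_transform c (k *\<^sub>C z) = k *\<^sub>C cayley_transform c z"
proof -
  obtain x where x: "x \<in> D" "z = A x + c *\<^sub>C x" by (rule shift_decomposition)
  then have "k *\<^sub>C z = A (k *\<^sub>C x) + c *\<^sub>C (k *\<^sub>C x)"
    by (simp add: A_scaleC scaleC_add_right scaleC_scaleC mult.commute)
  then show ?thesis
    using x scaleC_dom by (simp only: cayley_transform_shift)
      (simp add: A_scaleC scaleC_diff_right scaleC_scaleC mult.commute)
qed

lemma cinner_cayley_transform: "cinner (cayley_transform c y) (cayley_transform c z) = cinner y z"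
proof -
  obtain u v where uv: "u \<in> D" "y = A u + c *\<^sub>C u" "v \<in> D" "z = A v + c *\<^sub>C v"
    using shift_decomposition by metis
  have "cnj c = - c" using c by (simp add: complex_eq_iff)
  then show ?thesis
    using uv A_sym[of u v] by (simp add: cayley_transform_shift cinner_simps algebra_simps)
qed

lemma range_one_minus_cayley_transform: "range (\<lambda>w. w - cayley_transform c w) = D"
proof
  show "range (\<lambda>w. w - cayley_transform c w) \<subseteq> D"
    using scaleC_dom shift_inv_dom by (auto simp: cayley_transform_def)
  show "D \<subseteq> range (\<lambda>w. w - cayley_transform c w)"
  proof
    fix x assume x: "x \<in> D"
    define u where "u = (1 / (2 * c)) *\<^sub>C x"
    have "u \<in> D" using scaleC_dom x by (simp add: u_def)
    then have "(A u + c *\<^sub>C u) - cayley_transform c (A u + c *\<^sub>C u) = (2 * c) *\<^sub>C u"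
      by (simp add: cayley_transform_shift scaleC_double)
    also have "\<dots> = x" using c by (simp add: u_def scaleC_scaleC scaleC_one)
    finally show "x \<in> range (\<lambda>w. w - cayley_transform c w)" by (metis rangeI)
  qed
qed

lemma A_one_minus_cayley_transform:
  "A (w - cayley_transform c w) = c *\<^sub>C (w + cayley_transform c w)"
proof -
  obtain x where x: "x \<in> D" "w = A x + c *\<^sub>C x" by (rule shift_decomposition)
  then have "cayley_transform c w = A x - c *\<^sub>C x" by (simp add: cayley_transform_shift)
  then have diff: "w - cayley_transform c w = (2 * c) *\<^sub>C x" and sum: "w + cayley_transform c w = A x + A x"
    using x by (simp_all add: scaleC_double)
  show ?thesis unfolding diff sum A_scaleC[OF x(1)] by (simp add: scaleC_double scaleC_add_right)
qed

end

lemma surj_cayley_transform: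
  assumes c: "Re c = 0" "c \<noteq> 0"
  shows "surj (cayley_transform c)"
proof (rule surjI)
  fix z
  obtain x where "x \<in> D" "z = A x + (- c) *\<^sub>C x" using shift_decomposition[of "- c" z] c by auto
  then show "cayley_transform c (cayley_transform (- c) z) = z"
    using cayley_transform_shift[of c x] cayley_transform_shift[of "- c" x] c
    by (simp add: scaleC_minus_left)
qed

end

section \<open>Functionals on bounded Borel functions\<close>

definition bounded_borel :: "('a::topological_space \<Rightarrow> complex) \<Rightarrow> bool" where
  "bounded_borel f \<longleftrightarrow> f \<in> borel_measurable borel \<and> (\<exists>K. \<forall>s. cmod (f s) \<le> K)"

lemma bounded_borelI: "f \<in> borel_measurable borel \<Longrightarrow> (\<And>s. cmod (f s) \<le> K) \<Longrightarrow> bounded_borel f"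
  by (auto simp: bounded_borel_def)

lemma borel_measurable_bounded_borel: "bounded_borel f \<Longrightarrow> f \<in> borel_measurable borel"
  by (simp add: bounded_borel_def)

lemma bounded_borel_bound:
  assumes "bounded_borel f" obtains K where "K > 0" "\<And>s. cmod (f s) \<le> K"
proof -
  obtain K where K: "\<And>s. cmod (f s) \<le> K" using assms by (auto simp: bounded_borel_def)
  have "cmod (f s) \<le> \<bar>K\<bar> + 1" for s using K[of s] by linarith
  then show ?thesis using that[of "\<bar>K\<bar> + 1"] by auto
qed

lemma bounded_borel_const [intro, simp]: "bounded_borel (\<lambda>s. a)"
  by (rule bounded_borelI[where K = "cmod a"]) auto

lemma bounded_borel_add [intro]:
  assumes "bounded_borel f" "bounded_borel g" shows "bounded_borel (\<lambda>s. f s + g s)"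
proof -
  obtain K L where "\<And>s. cmod (f s) \<le> K" "\<And>s. cmod (g s) \<le> L"
    using assms by (auto simp: bounded_borel_def)
  with assms show ?thesis
    by (intro bounded_borelI[where K = "K + L"])
       (auto simp: bounded_borel_def intro!: norm_triangle_mono)
qed

lemma bounded_borel_mult [intro]:
  assumes "bounded_borel f" "bounded_borel g" shows "bounded_borel (\<lambda>s. f s * g s)"
proof -
  obtain K L where "K > 0" "L > 0" "\<And>s. cmod (f s) \<le> K" "\<And>s. cmod (g s) \<le> L"
    using bounded_borel_bound assms by metis
  with assms show ?thesis
    by (intro bounded_borelI[where K = "K * L"])
       (auto simp: bounded_borel_def norm_mult less_imp_le intro!: mult_mono)
qed

lemma bounded_borel_diff [intro]:
  "bounded_borel f \<Longrightarrow> bounded_borel g \<Longrightarrow> bounded_borel (\<lambda>s. f s - g s)"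
  using bounded_borel_add[OF _ bounded_borel_mult[OF bounded_borel_const[of "-1"]]] by simp

lemma bounded_borel_power [intro]: "bounded_borel f \<Longrightarrow> bounded_borel (\<lambda>s. f s ^ n)"
  by (induction n) auto

lemma bounded_borel_cnj [intro]: "bounded_borel f \<Longrightarrow> bounded_borel (\<lambda>s. cnj (f s))"
  unfolding bounded_borel_def
  by (simp add: borel_measurable_continuous_on[where f = cnj] continuous_on_cnj continuous_on_id)

lemma bounded_borel_sum [intro]:
  "(\<And>i. i \<in> I \<Longrightarrow> bounded_borel (f i)) \<Longrightarrow> bounded_borel (\<lambda>s. \<Sum>i\<in>I. f i s)"
  by (induction I rule: infinite_finite_induct) auto

lemma bounded_borel_indicator [intro]: "B \<in> sets borel \<Longrightarrow> bounded_borel (indicator B)"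
  by (rule bounded_borelI[where K = 1]) (auto simp: indicator_def)

lemma bounded_borel_indicator_times_continuous:
  fixes g :: "'a::t2_space \<Rightarrow> complex"
  assumes "compact C" "continuous_on UNIV g"
  shows "bounded_borel (\<lambda>s. indicator C s * g s)"
proof -
  have "bounded (g ` C)"
    using assms
    by (intro compact_imp_bounded compact_continuous_image) (auto intro: continuous_on_subset)
  then obtain K where "K > 0" "\<And>s. s \<in> C \<Longrightarrow> cmod (g s) \<le> K" by (auto simp: bounded_pos)
  moreover have "C \<in> sets borel" "g \<in> borel_measurable borel"
    using assms by (auto intro: borel_closed compact_imp_closed borel_measurable_continuous_onI)
  ultimately show ?thesis
    by (intro bounded_borelI[where K = K] borel_measurable_times borel_measurable_indicator)
       (auto simp: indicator_def norm_mult)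
qed

lemma integrable_bounded_borel:
  assumes "finite_measure M" and sets: "sets M = sets borel" and f: "bounded_borel f"
  shows "integrable M f"
proof -
  interpret finite_measure M by fact
  note [measurable_cong] = sets
  obtain K where "\<And>s. cmod (f s) \<le> K" using f by (auto simp: bounded_borel_def)
  moreover have "f \<in> borel_measurable M"
    using borel_measurable_bounded_borel[OF f] by measurable
  ultimately show ?thesis by (intro integrable_const_bound[where B = K]) auto
qed

definition sigma_functional :: "(('a::topological_space \<Rightarrow> complex) \<Rightarrow> complex) \<Rightarrow> bool" where
  "sigma_functional \<Lambda> \<longleftrightarrow>
     (\<forall>f g. bounded_borel f \<longrightarrow> bounded_borel g \<longrightarrow> \<Lambda> (\<lambda>s. f s + g s) = \<Lambda> f + \<Lambda> g) \<and>
     (\<forall>a f. bounded_borel f \<longrightarrow> \<Lambda> (\<lambda>s. a * f s) = a * \<Lambda> f) \<and>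
     (\<forall>F f K. (\<forall>n. F n \<in> borel_measurable borel) \<longrightarrow> (\<forall>n s. cmod (F n s) \<le> K) \<longrightarrow>
        (\<forall>s. (\<lambda>n. F n s) \<longlonglongrightarrow> f s) \<longrightarrow> (\<lambda>n. \<Lambda> (F n)) \<longlonglongrightarrow> \<Lambda> f)"

lemma
  assumes "sigma_functional \<Lambda>"
  shows sigma_functional_add_arg:
      "bounded_borel f \<Longrightarrow> bounded_borel g \<Longrightarrow> \<Lambda> (\<lambda>s. f s + g s) = \<Lambda> f + \<Lambda> g"
    and sigma_functional_cmult_arg: "bounded_borel f \<Longrightarrow> \<Lambda> (\<lambda>s. a * f s) = a * \<Lambda> f"
    and sigma_functional_tendsto:
      "(\<And>n. F n \<in> borel_measurable borel) \<Longrightarrow> (\<And>n s. cmod (F n s) \<le> K) \<Longrightarrow>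
        (\<And>s. (\<lambda>n. F n s) \<longlonglongrightarrow> h s) \<Longrightarrow> (\<lambda>n. \<Lambda> (F n)) \<longlonglongrightarrow> \<Lambda> h"
  using assms unfolding sigma_functional_def by blast+

lemmas sigma_functional_linear = sigma_functional_add_arg sigma_functional_cmult_arg

lemma sigma_functional_zero: "sigma_functional \<Lambda> \<Longrightarrow> \<Lambda> (\<lambda>s. 0) = 0"
  using sigma_functional_cmult_arg[of \<Lambda> "\<lambda>s. 1" 0] by simp

lemma sigma_functional_sum:
  assumes \<Lambda>: "sigma_functional \<Lambda>" and "\<And>i. i \<in> I \<Longrightarrow> bounded_borel (F i)"
  shows "\<Lambda> (\<lambda>s. \<Sum>i\<in>I. a i * F i s) = (\<Sum>i\<in>I. a i * \<Lambda> (F i))"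
  using assms(2)
  by (induction I rule: infinite_finite_induct)
     (simp_all add: sigma_functional_zero sigma_functional_linear[OF \<Lambda>] \<Lambda> bounded_borel_sum bounded_borel_mult)

lemma sigma_functional_limit_eq_0:
  assumes \<Lambda>: "sigma_functional \<Lambda>" and F: "\<And>n. F n \<in> borel_measurable borel" "\<And>n s. cmod (F n s) \<le> K"
    "\<And>s. (\<lambda>n. F n s) \<longlonglongrightarrow> f s"
    and zero: "\<And>n. \<Lambda> (F n) = 0"
  shows "\<Lambda> f = 0"
  using sigma_functional_tendsto[OF \<Lambda> F] by (simp add: zero LIMSEQ_const_iff)

lemma sigma_functional_integral:
  assumes M: "finite_measure M" "sets M = sets borel"
  shows "sigma_functional (\<lambda>f. \<integral>s. f s \<partial>M)"
proof -
  interpret finite_measure M by fact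
  note [measurable_cong] = M(2)
  show ?thesis unfolding sigma_functional_def
  proof (intro conjI allI impI)
    fix F :: "nat \<Rightarrow> 'a \<Rightarrow> complex" and f K
    assume F: "\<forall>n. F n \<in> borel_measurable borel" "\<forall>n s. cmod (F n s) \<le> K" "\<forall>s. (\<lambda>n. F n s) \<longlonglongrightarrow> f s"
    have [measurable]: "F n \<in> borel_measurable borel" for n using F by simp
    have [measurable]: "f \<in> borel_measurable borel"
      by (rule borel_measurable_LIMSEQ_metric[of F]) (use F in auto)
    show "(\<lambda>n. \<integral>s. F n s \<partial>M) \<longlonglongrightarrow> (\<integral>s. f s \<partial>M)"
      by (rule integral_dominated_convergence[where w = "\<lambda>_. K"]) (use F in auto)
  qed (auto simp: integrable_bounded_borel[OF M])
qed

lemma sigma_functional_add: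
  assumes \<Lambda>: "sigma_functional \<Lambda>" and \<Lambda>': "sigma_functional \<Lambda>'"
  shows "sigma_functional (\<lambda>f. \<Lambda> f + \<Lambda>' f)"
  unfolding sigma_functional_def
proof (intro conjI allI impI)
  fix F :: "nat \<Rightarrow> 'a \<Rightarrow> complex" and f K
  assume "\<forall>n. F n \<in> borel_measurable borel" "\<forall>n s. cmod (F n s) \<le> K" "\<forall>s. (\<lambda>n. F n s) \<longlonglongrightarrow> f s"
  then show "(\<lambda>n. \<Lambda> (F n) + \<Lambda>' (F n)) \<longlonglongrightarrow> \<Lambda> f + \<Lambda>' f"
    by (intro tendsto_add sigma_functional_tendsto[OF \<Lambda>, of F K] sigma_functional_tendsto[OF \<Lambda>', of F K]) auto
qed (simp_all add: sigma_functional_linear[OF \<Lambda>] sigma_functional_linear[OF \<Lambda>'] algebra_simps)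

lemma sigma_functional_cmult:
  assumes \<Lambda>: "sigma_functional \<Lambda>"
  shows "sigma_functional (\<lambda>f. a * \<Lambda> f)"
  unfolding sigma_functional_def
proof (intro conjI allI impI)
  fix F :: "nat \<Rightarrow> 'a \<Rightarrow> complex" and f K
  assume "\<forall>n. F n \<in> borel_measurable borel" "\<forall>n s. cmod (F n s) \<le> K" "\<forall>s. (\<lambda>n. F n s) \<longlonglongrightarrow> f s"
  then show "(\<lambda>n. a * \<Lambda> (F n)) \<longlonglongrightarrow> a * \<Lambda> f"
    by (intro tendsto_mult_left sigma_functional_tendsto[OF \<Lambda>, of F K]) auto
qed (simp_all add: sigma_functional_linear[OF \<Lambda>] algebra_simps)

lemma sigma_functional_mult:
  assumes \<Lambda>: "sigma_functional \<Lambda>" and g: "bounded_borel g"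
  shows "sigma_functional (\<lambda>f. \<Lambda> (\<lambda>s. f s * g s))"
  unfolding sigma_functional_def
proof (intro conjI allI impI)
  fix F :: "nat \<Rightarrow> 'a \<Rightarrow> complex" and f K
  assume F: "\<forall>n. F n \<in> borel_measurable borel" "\<forall>n s. cmod (F n s) \<le> K" "\<forall>s. (\<lambda>n. F n s) \<longlonglongrightarrow> f s"
  obtain L where L: "L > 0" "\<And>s. cmod (g s) \<le> L" using bounded_borel_bound[OF g] by metis
  have [measurable]: "g \<in> borel_measurable borel" "\<And>n. F n \<in> borel_measurable borel"
    using g F by (auto simp: bounded_borel_def)
  have "0 \<le> K" using F(2) norm_ge_zero order_trans by metis
  then show "(\<lambda>n. \<Lambda> (\<lambda>s. F n s * g s)) \<longlonglongrightarrow> \<Lambda> (\<lambda>s. f s * g s)"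
    using F L by (intro sigma_functional_tendsto[OF \<Lambda>, where K = "K * L"])
      (auto simp: norm_mult intro!: mult_mono tendsto_mult)
qed (simp_all add: sigma_functional_linear[OF \<Lambda>] bounded_borel_mult g distrib_right mult.assoc)

lemma sigma_functional_cnj:
  assumes \<Lambda>: "sigma_functional \<Lambda>"
  shows "sigma_functional (\<lambda>f. cnj (\<Lambda> (\<lambda>s. cnj (f s))))"
  unfolding sigma_functional_def
proof (intro conjI allI impI)
  fix F :: "nat \<Rightarrow> 'a \<Rightarrow> complex" and f K
  assume F: "\<forall>n. F n \<in> borel_measurable borel" "\<forall>n s. cmod (F n s) \<le> K" "\<forall>s. (\<lambda>n. F n s) \<longlonglongrightarrow> f s"
  have "(\<lambda>s. cnj (F n s)) \<in> borel_measurable borel" for n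
    by (rule borel_measurable_continuous_on[where f = cnj])
       (use F in \<open>auto intro!: continuous_intros\<close>)
  then show "(\<lambda>n. cnj (\<Lambda> (\<lambda>s. cnj (F n s)))) \<longlonglongrightarrow> cnj (\<Lambda> (\<lambda>s. cnj (f s)))"
    using F
    by (intro tendsto_cnj sigma_functional_tendsto[OF \<Lambda>, where K = K]) (auto intro!: tendsto_cnj)
qed (simp_all add: sigma_functional_linear[OF \<Lambda>] bounded_borel_cnj)

lemma sum_indicator_disjoint_family:
  fixes F :: "nat \<Rightarrow> 'a set"
  assumes "disjoint_family F"
  shows "(\<Sum>i<n. indicator (F i) s :: 'b::semiring_1) = indicator (\<Union>i<n. F i) s"
  using assms by (intro indicator_UN_disjoint[symmetric]) (auto simp: disjoint_family_on_def)

lemma sigma_functional_indicator_UN_eq_0: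
  assumes \<Lambda>: "sigma_functional \<Lambda>" and F: "\<And>i::nat. F i \<in> sets borel" "disjoint_family F"
    and zero: "\<And>i. \<Lambda> (indicator (F i)) = 0"
  shows "\<Lambda> (indicator (\<Union>i. F i)) = 0"
proof (rule sigma_functional_limit_eq_0[OF \<Lambda>, where K = 1])
  note sum_indicator = sum_indicator_disjoint_family[OF F(2), where 'b = complex]
  show "(\<lambda>s. \<Sum>i<n. indicator (F i) s :: complex) \<in> borel_measurable borel" for n
    using F by (intro borel_measurable_sum) auto
  show "cmod (\<Sum>i<n. indicator (F i) s) \<le> 1" for n s
    unfolding sum_indicator by (simp add: indicator_def)
  show "(\<lambda>n. \<Sum>i<n. indicator (F i) s :: complex) \<longlonglongrightarrow> indicator (\<Union>i. F i) s" for s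
    unfolding sum_indicator by (rule LIMSEQ_indicator_UN)
  show "\<Lambda> (\<lambda>s. \<Sum>i<n. indicator (F i) s) = 0" for n
    using sigma_functional_sum[OF \<Lambda>, of "{..<n}" "\<lambda>i. indicator (F i)" "\<lambda>_. 1"] F zero
    by (simp add: bounded_borel_indicator)
qed

lemma sigma_functional_indicator_eq_0:
  assumes \<Lambda>: "sigma_functional \<Lambda>"
    and G: "sets (borel::'a::topological_space measure) = sigma_sets UNIV G" "Int_stable G"
    and zero: "\<And>A. A \<in> G \<Longrightarrow> \<Lambda> (indicator A) = 0" "\<Lambda> (\<lambda>_. 1) = 0"
    and B: "(B::'a set) \<in> sets borel"
  shows "\<Lambda> (indicator B) = 0"
proof -
  have "G \<subseteq> Pow UNIV" by simp
  with G(2) show ?thesis using B[unfolded G(1)]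
  proof (induction B rule: sigma_sets_induct_disjoint)
    case (basic A)
    then show ?case by (rule zero(1))
  next
    case empty
    have "indicator {} = (\<lambda>s::'a. 0::complex)" by auto
    then show ?case using sigma_functional_zero[OF \<Lambda>] by simp
  next
    case (compl A)
    then have A: "bounded_borel (indicator A :: 'a \<Rightarrow> complex)" using G by auto
    have "indicator (UNIV - A) = (\<lambda>s. 1 + (-1) * (indicator A s :: complex))"
      by (auto simp: indicator_def)
    then have "\<Lambda> (indicator (UNIV - A)) = \<Lambda> (\<lambda>s. 1) + (-1) * \<Lambda> (indicator A)"
      using A by (simp only: sigma_functional_linear[OF \<Lambda>] bounded_borel_mult bounded_borel_const)
    then show ?case using compl zero(2) by simp
  next
    case (union F)
    then have F: "F i \<in> sets borel" for i using G by auto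
    show ?case using union by (intro sigma_functional_indicator_UN_eq_0[OF \<Lambda>] F) auto
  qed
qed

lemma simple_function_eq_sum_indicator:
  fixes f :: "'a \<Rightarrow> 'b::semiring_1"
  assumes "finite (range f)"
  shows "f = (\<lambda>s. \<Sum>y\<in>range f. y * indicator (f -` {y}) s)"
proof
  fix s
  have "(\<Sum>y\<in>range f. y * indicator (f -` {y}) s) = (\<Sum>y\<in>range f. if y = f s then y else 0)"
    by (intro sum.cong) (auto simp: indicator_def)
  then show "f s = (\<Sum>y\<in>range f. y * indicator (f -` {y}) s)" using assms by simp
qed

lemma sigma_functional_eq_0_if_indicators:
  assumes \<Lambda>: "sigma_functional \<Lambda>" and zero: "\<And>B. B \<in> sets borel \<Longrightarrow> \<Lambda> (indicator B) = 0"
    and f: "bounded_borel f"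
  shows "\<Lambda> f = 0"
proof -
  obtain K where K: "\<And>s. cmod (f s) \<le> K" using f by (auto simp: bounded_borel_def)
  obtain F where F: "\<And>i. simple_function borel (F i)" "\<And>x. (\<lambda>i. F i x) \<longlonglongrightarrow> f x"
      "\<And>i x. dist (F i x) 0 \<le> 2 * dist (f x) 0"
    using borel_measurable_implies_sequence_metric[OF borel_measurable_bounded_borel[OF f], of 0]
    by auto
  show ?thesis
  proof (rule sigma_functional_limit_eq_0[OF \<Lambda>, where K = "2 * K"])
    show "cmod (F i s) \<le> 2 * K" for i s using F(3)[of i s] K[of s] by simp
    show "\<Lambda> (F i) = 0" for i
    proof -
      have "F i -` {y} \<in> sets borel" for y
        using measurable_sets[OF borel_measurable_simple_function[OF F(1)[of i]], of "{y}"] by simp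
      then have "\<Lambda> (\<lambda>s. \<Sum>y\<in>range (F i). y * indicator (F i -` {y}) s) = 0"
        by (subst sigma_functional_sum[OF \<Lambda>]) (auto simp: zero)
      moreover have "finite (range (F i))" using F(1)[of i] by (simp add: simple_function_def)
      ultimately show ?thesis by (subst simple_function_eq_sum_indicator)
    qed
  qed (use F in \<open>auto intro: borel_measurable_simple_function\<close>)
qed

lemma sigma_functional_uniform_limit_eq_0:
  assumes \<Lambda>: "sigma_functional \<Lambda>" and f: "bounded_borel f"
    and approx: "\<And>e. e > 0 \<Longrightarrow> \<exists>g\<in>borel_measurable borel. \<Lambda> g = 0 \<and> (\<forall>s. cmod (f s - g s) < e)"
  shows "\<Lambda> f = 0"
proof -
  obtain K where K: "\<And>s. cmod (f s) \<le> K" using f by (auto simp: bounded_borel_def)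
  have "\<exists>g\<in>borel_measurable borel. \<Lambda> g = 0 \<and> (\<forall>s. cmod (f s - g s) < inverse (real (Suc n)))" for n
    by (intro approx) simp
  then obtain F where F: "\<And>n. F n \<in> borel_measurable borel" "\<And>n. \<Lambda> (F n) = 0"
      "\<And>n s. cmod (f s - F n s) < inverse (real (Suc n))" by metis
  show ?thesis
  proof (rule sigma_functional_limit_eq_0[OF \<Lambda> F(1) _ _ F(2), where K = "K + 1"])
    show "cmod (F n s) \<le> K + 1" for n s
    proof -
      have "inverse (real (Suc n)) \<le> 1" by (simp add: inverse_le_1_iff)
      then show ?thesis
        using K[of s] F(3)[of s n] norm_triangle_sub[of "F n s" "f s"] norm_minus_commute[of "F n s" "f s"]
        by linarith
    qed
    have "(\<lambda>n. F n s - f s) \<longlonglongrightarrow> 0" for s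
      by (rule Lim_null_comparison[OF _ LIMSEQ_inverse_real_of_nat])
         (auto intro!: always_eventually less_imp_le F(3) simp: norm_minus_commute[of _ "f s"] simp del: of_nat_Suc)
    then show "(\<lambda>n. F n s) \<longlonglongrightarrow> f s" for s by (rule LIM_zero_cancel)
  qed
qed

context
  fixes \<Lambda> :: "('a::topological_space \<Rightarrow> complex) \<Rightarrow> complex" and h :: "'a \<Rightarrow> real" and K :: real
  assumes \<Lambda>: "sigma_functional \<Lambda>" and h: "h \<in> borel_measurable borel" "\<And>s. \<bar>h s\<bar> \<le> K"
    and powers: "\<And>k. \<Lambda> (\<lambda>s. of_real (h s) ^ k) = 0"
begin

lemma sigma_functional_comp_polynomial_eq_0:
  assumes "real_polynomial_function p"
  shows "\<Lambda> (\<lambda>s. of_real (p (h s))) = 0"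
proof -
  obtain c d where "p = (\<lambda>y. \<Sum>i\<le>d. c i * y ^ i)"
    using assms unfolding real_polynomial_function_iff_sum by blast
  moreover have "bounded_borel (\<lambda>s. complex_of_real (h s) ^ k)" for k
    using h by (intro bounded_borel_power bounded_borelI[where K = K]) auto
  ultimately show ?thesis
    using sigma_functional_sum[OF \<Lambda>, of "{..d}" "\<lambda>i s. of_real (h s) ^ i" "\<lambda>i. of_real (c i)"] powers
    by simp
qed

lemma sigma_functional_comp_continuous_eq_0:
  assumes g: "continuous_on UNIV g"
  shows "\<Lambda> (\<lambda>s. of_real (g (h s))) = 0"
proof (rule sigma_functional_uniform_limit_eq_0[OF \<Lambda>])
  have h_mem: "h s \<in> {-K..K}" for s using h(2)[of s] by (auto simp: abs_le_iff)
  have g_Icc: "continuous_on {-K..K} g" using g continuous_on_subset by blast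
  then have "bounded (g ` {-K..K})"
    by (intro compact_imp_bounded compact_continuous_image compact_Icc)
  then obtain L where "\<And>y. y \<in> {-K..K} \<Longrightarrow> \<bar>g y\<bar> \<le> L"
    unfolding bounded_iff by (auto simp del: atLeastAtMost_iff)
  then have "cmod (of_real (g (h s))) \<le> L" for s using h_mem by (simp del: atLeastAtMost_iff)
  moreover have "(\<lambda>s. g (h s)) \<in> borel_measurable borel"
    by (rule borel_measurable_continuous_on[OF g h(1)])
  ultimately show "bounded_borel (\<lambda>s. complex_of_real (g (h s)))"
    by (intro bounded_borelI[where K = L]) measurable
  fix e :: real assume "e > 0"
  then obtain p where p: "real_polynomial_function p" "\<And>y. y \<in> {-K..K} \<Longrightarrow> \<bar>g y - p y\<bar> < e"
    using Stone_Weierstrass_real_polynomial_function[OF compact_Icc g_Icc] by blast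
  have [measurable]: "p \<in> borel_measurable borel"
    using p(1) by (intro borel_measurable_continuous_onI continuous_on_polymonial_function)
      (simp add: real_polynomial_function_eq)
  have "cmod (of_real (g (h s)) - of_real (p (h s))) < e" for s
    using p(2)[OF h_mem[of s]] by (simp flip: of_real_diff)
  moreover have "(\<lambda>s. complex_of_real (p (h s))) \<in> borel_measurable borel" using h(1) by measurable
  ultimately show "\<exists>f\<in>borel_measurable borel. \<Lambda> f = 0 \<and> (\<forall>s. cmod (of_real (g (h s)) - f s) < e)"
    using sigma_functional_comp_polynomial_eq_0[OF p(1)] by blast
qed

end

lemma tendsto_clamp_indicator_neg:
  "(\<lambda>n. min 1 (max 0 (- (real n * y)))) \<longlonglongrightarrow> indicator {..<0} y"
proof (rule tendsto_eventually, cases "y < 0")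
  case True
  then obtain n0 where n0: "real n0 * (- y) > 1" using ex_less_of_nat_mult[of "- y" 1] by auto
  show "\<forall>\<^sub>F n in sequentially. min 1 (max 0 (- (real n * y))) = indicator {..<0} y"
  proof (rule eventually_sequentiallyI)
    fix n assume "n0 \<le> n"
    then have "real n * (- y) \<ge> real n0 * (- y)" using True by (intro mult_right_mono) auto
    then have "- (real n * y) \<ge> 1" using n0 by simp
    then show "min 1 (max 0 (- (real n * y))) = indicator {..<0} y" using True by auto
  qed
next
  case False
  then have "max 0 (- (real n * y)) = 0" for n by auto
  then show "\<forall>\<^sub>F n in sequentially. min 1 (max 0 (- (real n * y))) = indicator {..<0} y"
    using False by simp
qed

lemma sigma_functional_sublevel_eq_0:
  fixes h :: "'a::topological_space \<Rightarrow> real"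
  assumes \<Lambda>: "sigma_functional \<Lambda>" and h: "h \<in> borel_measurable borel" "\<And>s. \<bar>h s\<bar> \<le> K"
    and powers: "\<And>k. \<Lambda> (\<lambda>s. of_real (h s) ^ k) = 0"
  shows "\<Lambda> (indicator {s. h s < 0}) = 0"
proof (rule sigma_functional_limit_eq_0[OF \<Lambda>, where K = 1])
  let ?g = "\<lambda>n y. min 1 (max 0 (- (real n * y)))"
  show "(\<lambda>s. complex_of_real (?g n (h s))) \<in> borel_measurable borel" for n using h(1) by measurable
  show "cmod (of_real (?g n (h s))) \<le> 1" for n s by auto
  show "(\<lambda>n. complex_of_real (?g n (h s))) \<longlonglongrightarrow> indicator {s. h s < 0} s" for s
    using tendsto_of_real[OF tendsto_clamp_indicator_neg[of "h s"], where 'a = complex]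
    by (cases "h s < 0") (simp_all add: indicator_def)
  show "\<Lambda> (\<lambda>s. of_real (?g n (h s))) = 0" for n
    by (rule sigma_functional_comp_continuous_eq_0[OF \<Lambda> h powers]) (intro continuous_intros)
qed

section \<open>Functionals determined by powers of the Cayley function\<close>

definition cayley :: "real \<Rightarrow> complex" where
  "cayley s = (of_real s - \<i>) / (of_real s + \<i>)"

lemma of_real_plus_minus_ii_nonzero: "of_real s + \<i> \<noteq> 0" "of_real s - \<i> \<noteq> 0"
  by (auto simp: complex_eq_iff)

lemma square_plus_one_pos: "(s::real)\<^sup>2 + 1 > 0"
  by (simp add: add_nonneg_pos)

lemma Re_cayley: "Re (cayley s) = (s\<^sup>2 - 1) / (s\<^sup>2 + 1)"
  and Im_cayley: "Im (cayley s) = - 2 * s / (s\<^sup>2 + 1)"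
  by (auto simp: cayley_def Re_divide Im_divide power2_eq_square)

lemma norm_cayley [simp]: "cmod (cayley s) = 1"
proof -
  have "cmod (of_real s - \<i>) = cmod (of_real s + \<i>)" by (simp add: cmod_def)
  then show ?thesis by (simp add: cayley_def norm_divide of_real_plus_minus_ii_nonzero)
qed

lemma cayley_nonzero [simp]: "cayley s \<noteq> 0"
  using norm_cayley[of s] by (metis norm_zero zero_neq_one)

lemma cnj_cayley: "cnj (cayley s) = inverse (cayley s)"
  using complex_norm_square[of "cayley s"] by (simp add: field_simps)

lemma cnj_cayley_powi: "cnj (cayley s powi n) = cayley s powi (- n)"
  by (simp add: complex_cnj_power_int cnj_cayley power_int_inverse power_int_minus)

lemma one_minus_cayley: "1 - cayley s = 2 * \<i> / (of_real s + \<i>)"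
  using of_real_plus_minus_ii_nonzero(1)[of s] by (simp add: cayley_def field_simps)

lemma of_real_mult_one_minus_cayley: "of_real s * (1 - cayley s) = \<i> * (1 + cayley s)"
  using of_real_plus_minus_ii_nonzero(1)[of s] by (simp add: cayley_def field_simps)

lemma continuous_on_cayley: "continuous_on UNIV cayley"
  unfolding cayley_def by (intro continuous_intros) (simp add: complex_eq_iff)

lemma bounded_borel_cayley_powi [intro]: "bounded_borel (\<lambda>s. cayley s powi n)"
proof (rule bounded_borelI[where K = 1])
  show "(\<lambda>s. cayley s powi n) \<in> borel_measurable borel"
    by (intro borel_measurable_continuous_onI continuous_on_power_int continuous_on_cayley) auto
qed (simp add: norm_power_int)

lemma bounded_borel_cayley [intro]: "bounded_borel cayley"
  using bounded_borel_cayley_powi[of 1] by simp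

lemma interval_function_eq_cayley:
  fixes a b s :: real
  defines "\<beta> \<equiv> Complex (- (a * b - 1) / 4) (- (a + b) / 4)"
  shows "complex_of_real ((s - a) * (s - b) / (s\<^sup>2 + 1))
    = of_real ((a * b + 1) / 2) + \<beta> * cayley s + cnj \<beta> * inverse (cayley s)"
proof -
  have "(a * b + 1) / 2 + 2 * (- (a * b - 1) / 4 * ((s\<^sup>2 - 1) / (s\<^sup>2 + 1))
      - - (a + b) / 4 * (- 2 * s / (s\<^sup>2 + 1))) = (s - a) * (s - b) / (s\<^sup>2 + 1)"
    using square_plus_one_pos[of s]
    by (simp add: divide_simps less_imp_neq[symmetric]) (simp add: algebra_simps power2_eq_square)
  then show ?thesis
    by (simp add: cnj_cayley[symmetric] complex_eq_iff \<beta>_def Re_cayley Im_cayley)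
qed

lemma sigma_functional_trig_polynomial_power_eq_0:
  assumes \<Lambda>: "sigma_functional \<Lambda>" and zero: "\<And>n::int. \<Lambda> (\<lambda>s. cayley s powi n) = 0"
    and h: "\<And>s. h s = \<alpha> + \<beta> * cayley s + \<gamma> * inverse (cayley s)"
  shows "\<Lambda> (\<lambda>s. h s ^ k * cayley s powi m) = 0"
proof (induction k arbitrary: m)
  case (Suc k)
  let ?g = "\<lambda>m s. h s ^ k * cayley s powi m"
  have "h = (\<lambda>s. \<alpha> + \<beta> * cayley s powi 1 + \<gamma> * cayley s powi (-1))"
    by (simp add: h fun_eq_iff power_int_minus)
  then have "bounded_borel h"
    by (simp only:)
       (intro bounded_borel_add bounded_borel_mult bounded_borel_const bounded_borel_cayley_powi)
  then have g: "bounded_borel (?g m)" for m by auto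
  have "h s ^ Suc k * cayley s powi m = (\<alpha> + \<beta> * cayley s + \<gamma> * inverse (cayley s)) * ?g m s" for s
    by (simp only: power_Suc mult.assoc flip: h)
  then have "h s ^ Suc k * cayley s powi m = (\<alpha> * ?g m s + \<beta> * ?g (m + 1) s) + \<gamma> * ?g (m - 1) s" for s
    by (simp add: power_int_add power_int_diff field_simps)
  then have "(\<lambda>s. h s ^ Suc k * cayley s powi m)
      = (\<lambda>s. (\<alpha> * ?g m s + \<beta> * ?g (m + 1) s) + \<gamma> * ?g (m - 1) s)" by blast
  then show ?case
    using Suc.IH g by (simp only: sigma_functional_linear[OF \<Lambda>] bounded_borel_add bounded_borel_mult
      bounded_borel_const) simp
qed (simp add: zero)

text \<open>The interval \<open>(a, b)\<close> is the set where the real trigonometric polynomial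
  \<open>(s - a) (s - b) / (s\<^sup>2 + 1)\<close> in the Cayley variable is negative.\<close>
lemma sigma_functional_indicator_interval_eq_0:
  assumes \<Lambda>: "sigma_functional \<Lambda>" and zero: "\<And>n::int. \<Lambda> (\<lambda>s. cayley s powi n) = 0"
  shows "\<Lambda> (indicator {a<..<b}) = 0"
proof (cases "a < b")
  case True
  define h where "h s = (s - a) * (s - b) / (s\<^sup>2 + 1)" for s :: real
  define \<beta> where "\<beta> = Complex (- (a * b - 1) / 4) (- (a + b) / 4)"
  note h_eq = interval_function_eq_cayley[of _ a b, folded \<beta>_def h_def]
  have "h s < 0 \<longleftrightarrow> s \<in> {a<..<b}" for s
    unfolding h_def using square_plus_one_pos[of s] True
    by (auto simp: divide_less_0_iff mult_less_0_iff)
  then have "{a<..<b} = {s. h s < 0}" by blast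
  moreover have "\<Lambda> (indicator {s. h s < 0}) = 0"
  proof (rule sigma_functional_sublevel_eq_0[OF \<Lambda>])
    show "h \<in> borel_measurable borel" unfolding h_def by measurable
    have "cmod (of_real (h s)) \<le> \<bar>(a * b + 1) / 2\<bar> + cmod \<beta> + cmod \<beta>" for s
      unfolding h_eq
      by (intro norm_triangle_mono) (auto simp: norm_mult norm_inverse simp del: of_real_divide)
    then show "\<bar>h s\<bar> \<le> \<bar>(a * b + 1) / 2\<bar> + cmod \<beta> + cmod \<beta>" for s by simp
    show "\<Lambda> (\<lambda>s. of_real (h s) ^ k) = 0" for k
      using sigma_functional_trig_polynomial_power_eq_0[OF \<Lambda> zero h_eq, of k 0] by simp
  qed
  ultimately show ?thesis by simp
next
  case False
  then have "indicator {a<..<b} = (\<lambda>s. 0::complex)" by auto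
  then show ?thesis using sigma_functional_zero[OF \<Lambda>] by simp
qed

proposition sigma_functional_eq_0_if_cayley_powi:
  assumes \<Lambda>: "sigma_functional \<Lambda>" and zero: "\<And>n::int. \<Lambda> (\<lambda>s. cayley s powi n) = 0"
    and f: "bounded_borel f"
  shows "\<Lambda> f = 0"
proof (rule sigma_functional_eq_0_if_indicators[OF \<Lambda> _ f])
  let ?G = "range (\<lambda>(a, b). {a<..<b::real})"
  show "\<Lambda> (indicator B) = 0" if "B \<in> sets borel" for B
  proof (rule sigma_functional_indicator_eq_0[OF \<Lambda> _ _ _ _ that])
    show "sets (borel :: real measure) = sigma_sets UNIV ?G"
      unfolding borel_eq_box[where 'a = real] box_real by simp
    show "Int_stable ?G" unfolding Int_stable_def by (auto simp: Int_greaterThanLessThan)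
    show "\<Lambda> (indicator A) = 0" if "A \<in> ?G" for A
      using that sigma_functional_indicator_interval_eq_0[OF \<Lambda> zero] by auto
    show "\<Lambda> (\<lambda>_. 1) = 0" using zero[of 0] by simp
  qed
qed

corollary sigma_functional_eqI:
  assumes \<Lambda>: "sigma_functional \<Lambda>" and \<Lambda>': "sigma_functional \<Lambda>'"
    and eq: "\<And>n::int. \<Lambda> (\<lambda>s. cayley s powi n) = \<Lambda>' (\<lambda>s. cayley s powi n)"
    and f: "bounded_borel f"
  shows "\<Lambda> f = \<Lambda>' f"
proof -
  have "sigma_functional (\<lambda>f. \<Lambda> f + (-1) * \<Lambda>' f)"
    by (intro sigma_functional_add sigma_functional_cmult \<Lambda> \<Lambda>')
  from sigma_functional_eq_0_if_cayley_powi[OF this _ f] show ?thesis by (simp add: eq)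
qed

section \<open>Positive definite sequences and Herglotz' theorem\<close>

definition positive_definite :: "(int \<Rightarrow> complex) \<Rightarrow> bool" where
  "positive_definite a \<longleftrightarrow>
     (\<forall>N c. (\<Sum>j<N. \<Sum>k<N. c j * cnj (c k) * a (int j - int k)) \<in> \<real>\<^sub>\<ge>\<^sub>0)"

definition fejer_mean :: "(int \<Rightarrow> complex) \<Rightarrow> nat \<Rightarrow> real \<Rightarrow> complex" where
  "fejer_mean a N \<theta> =
     (\<Sum>j<N. \<Sum>k<N. cis (of_int (int k - int j) * \<theta>) * a (int j - int k)) / of_real (2 * pi * real N)"

definition fejer_density :: "(int \<Rightarrow> complex) \<Rightarrow> nat \<Rightarrow> real \<Rightarrow> real" where
  "fejer_density a N \<theta> = indicator {0..2*pi} \<theta> * Re (fejer_mean a N \<theta>)"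

definition fejer_measure :: "(int \<Rightarrow> complex) \<Rightarrow> nat \<Rightarrow> real measure" where
  "fejer_measure a N = density lborel (\<lambda>\<theta>. ennreal (fejer_density a N \<theta>))"

lemma fejer_mean_nonneg:
  assumes "positive_definite a"
  shows "fejer_mean a N \<theta> \<in> \<real>\<^sub>\<ge>\<^sub>0"
proof -
  have "cis (- (real j * \<theta>)) * cnj (cis (- (real k * \<theta>))) = cis (of_int (int k - int j) * \<theta>)" for j k
    by (simp add: cis_cnj cis_mult algebra_simps)
  then have "(\<Sum>j<N. \<Sum>k<N. cis (of_int (int k - int j) * \<theta>) * a (int j - int k)) \<in> \<real>\<^sub>\<ge>\<^sub>0"
    using assms[unfolded positive_definite_def, rule_format, where c = "\<lambda>j. cis (- (real j * \<theta>))" and N = N]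
    by (simp only:)
  then show ?thesis unfolding fejer_mean_def by (rule nonneg_Reals_divide_I) simp
qed

lemma
  assumes "positive_definite a"
  shows fejer_density_nonneg: "fejer_density a N \<theta> \<ge> 0"
    and of_real_fejer_density:
      "complex_of_real (fejer_density a N \<theta>) = of_real (indicator {0..2*pi} \<theta>) * fejer_mean a N \<theta>"
  using fejer_mean_nonneg[OF assms, of N \<theta>]
  by (auto simp: fejer_density_def complex_nonneg_Reals_iff complex_eq_iff)

lemma borel_measurable_cis [measurable]: "cis \<in> borel_measurable borel"
  by (intro borel_measurable_continuous_onI continuous_intros)

lemma has_bochner_integral_cis:
  fixes m :: int
  shows "has_bochner_integral lborel (\<lambda>\<theta>. indicator {0..2*pi} \<theta> *\<^sub>R cis (of_int m * \<theta>))
    (if m = 0 then of_real (2 * pi) else 0)"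
proof (cases "m = 0")
  case True
  then show ?thesis
    using has_bochner_integral_FTC_Icc[of 0 "2*pi" "\<lambda>x. of_real x" "\<lambda>x. 1::complex"]
      bounded_linear.has_vector_derivative[OF bounded_linear_of_real has_vector_derivative_id]
    by auto
next
  case False
  let ?F = "\<lambda>\<theta>. cis (of_int m * \<theta>) / (\<i> * of_int m)"
  have "((\<lambda>z. exp (\<i> * of_int m * z) / (\<i> * of_int m)) has_field_derivative exp (\<i> * of_int m * z)) (at z)" for z
    using False by (auto intro!: derivative_eq_intros)
  then have "(?F has_vector_derivative cis (of_int m * \<theta>)) (at \<theta> within {0..2*pi})" for \<theta>
    using has_vector_derivative_real_field[of "\<lambda>z. exp (\<i> * of_int m * z) / (\<i> * of_int m)"]
    by (simp add: cis_conv_exp mult.assoc)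
  then have "has_bochner_integral lborel (\<lambda>\<theta>. indicator {0..2*pi} \<theta> *\<^sub>R cis (of_int m * \<theta>)) (?F (2*pi) - ?F 0)"
    by (intro has_bochner_integral_FTC_Icc) (auto intro!: continuous_intros)
  moreover have "cis (of_int m * (2 * pi)) = 1"
    using cis_multiple_2pi[of "of_int m"] by (simp add: mult_ac)
  ultimately show ?thesis using False by simp
qed

lemma sum_sum_delta_shift:
  fixes c :: "'a::comm_semiring_1"
  assumes "n \<le> N"
  shows "(\<Sum>j<N. \<Sum>k<N. if j = k + n then c else 0) = of_nat (N - n) * c"
proof -
  have "(\<Sum>j<N. \<Sum>k<N. if j = k + n then c else 0) = (\<Sum>k<N. \<Sum>j<N. if j = k + n then c else 0)"
    by (rule sum.swap)
  also have "\<dots> = (\<Sum>k<N. if k + n < N then c else 0)"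
    by (intro sum.cong) auto
  also have "\<dots> = (\<Sum>k | k < N \<and> k + n < N. c)"
    by (simp add: sum.If_cases Int_def lessThan_def)
  also have "{k. k < N \<and> k + n < N} = {..<N - n}" by auto
  finally show ?thesis by simp
qed

lemma fejer_density_moment:
  assumes a: "positive_definite a" and N: "n \<le> N" "N > 0"
  shows "has_bochner_integral lborel (\<lambda>\<theta>. fejer_density a N \<theta> *\<^sub>R cis (real n * \<theta>))
    (of_real (1 - real n / real N) * a (int n))"
proof -
  let ?c = "complex_of_real (1 / (2 * pi * real N))"
  have cis_shift: "cis (real n * \<theta>) * cis (of_int (int k - int j) * \<theta>)
      = cis (of_int (int n + int k - int j) * \<theta>)" for j k \<theta>
    by (simp add: cis_mult algebra_simps)
  have expand: "fejer_density a N \<theta> *\<^sub>R cis (real n * \<theta>)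
      = ?c * (\<Sum>j<N. \<Sum>k<N.
          (indicator {0..2*pi} \<theta> *\<^sub>R cis (of_int (int n + int k - int j) * \<theta>)) * a (int j - int k))" for \<theta>
  proof -
    have "fejer_density a N \<theta> *\<^sub>R cis (real n * \<theta>)
        = ?c * (\<Sum>j<N. \<Sum>k<N. of_real (indicator {0..2*pi} \<theta>)
            * (cis (real n * \<theta>) * cis (of_int (int k - int j) * \<theta>)) * a (int j - int k))"
      by (simp add: scaleR_conv_of_real of_real_fejer_density[OF a] fejer_mean_def sum_distrib_left
          sum_distrib_right sum_divide_distrib mult_ac)
    then show ?thesis by (simp only: cis_shift scaleR_conv_of_real)
  qed
  have "has_bochner_integral lborel (\<lambda>\<theta>. fejer_density a N \<theta> *\<^sub>R cis (real n * \<theta>))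
    (?c * (\<Sum>j<N. \<Sum>k<N. (if int n + int k - int j = 0 then of_real (2 * pi) else 0) * a (int j - int k)))"
    unfolding expand
    by (intro has_bochner_integral_mult_right has_bochner_integral_sum has_bochner_integral_mult_left
        has_bochner_integral_cis)
  also have "(\<Sum>j<N. \<Sum>k<N. (if int n + int k - int j = 0 then of_real (2 * pi) else 0) * a (int j - int k))
     = (\<Sum>j<N. \<Sum>k<N. if j = k + n then of_real (2 * pi) * a (int n) else 0)"
    by (intro sum.cong) auto
  also have "\<dots> = of_nat (N - n) * (of_real (2 * pi) * a (int n))"
    using N by (intro sum_sum_delta_shift)
  also have "?c * \<dots> = of_real (1 - real n / real N) * a (int n)"
    using N by (simp add: field_simps of_nat_diff)
  finally show ?thesis .
qed

lemma borel_measurable_fejer_density [measurable]: "fejer_density a N \<in> borel_measurable borel"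
  unfolding fejer_density_def fejer_mean_def
  by measurable

lemma integral_cis_fejer_measure:
  assumes a: "positive_definite a" and N: "n \<le> N" "N > 0"
  shows "(\<integral>\<theta>. cis (real n * \<theta>) \<partial>fejer_measure a N) = of_real (1 - real n / real N) * a (int n)"
proof -
  have "(\<integral>\<theta>. cis (real n * \<theta>) \<partial>fejer_measure a N)
      = (\<integral>\<theta>. fejer_density a N \<theta> *\<^sub>R cis (real n * \<theta>) \<partial>lborel)"
    unfolding fejer_measure_def
    by (rule integral_density)
       (auto simp: fejer_density_nonneg[OF a] intro!: borel_measurable_continuous_onI continuous_intros)
  then show ?thesis using fejer_density_moment[OF a N] by (simp add: has_bochner_integral_iff)
qed

lemma tendsto_integral_cis_fejer_measure:
  assumes "positive_definite a"
  shows "(\<lambda>N. \<integral>\<theta>. cis (real n * \<theta>) \<partial>fejer_measure a (Suc N)) \<longlonglongrightarrow> a (int n)"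
proof -
  let ?m = "\<lambda>N. of_real (1 - real n / real (Suc N)) * a (int n)"
  have "?m \<longlonglongrightarrow> of_real (1 - 0) * a (int n)"
    by (intro tendsto_intros LIMSEQ_Suc lim_const_over_n)
  moreover have "\<forall>\<^sub>F N in sequentially. (\<integral>\<theta>. cis (real n * \<theta>) \<partial>fejer_measure a (Suc N)) = ?m N"
    by (intro eventually_sequentiallyI[of n] integral_cis_fejer_measure assms) auto
  ultimately show ?thesis by (subst tendsto_cong) auto
qed

lemma nn_integral_fejer_density:
  assumes a: "positive_definite a" "a 0 = 1" and "N > 0"
  shows "(\<integral>\<^sup>+\<theta>. ennreal (fejer_density a N \<theta>) \<partial>lborel) = 1"
proof -
  have "has_bochner_integral lborel (\<lambda>\<theta>. Re (fejer_density a N \<theta> *\<^sub>R cis (real 0 * \<theta>)))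
      (Re (of_real (1 - real 0 / real N) * a (int 0)))"
    using assms
    by (intro has_bochner_integral_bounded_linear[OF bounded_linear_Re] fejer_density_moment) auto
  then have "has_bochner_integral lborel (fejer_density a N) 1" using a by simp
  then show ?thesis
    using nn_integral_eq_integral[of lborel "fejer_density a N"]
    by (simp add: has_bochner_integral_iff fejer_density_nonneg[OF a(1)])
qed

lemma real_distribution_fejer_measure:
  assumes "positive_definite a" "a 0 = 1" "N > 0"
  shows "real_distribution (fejer_measure a N)"
  unfolding real_distribution_def real_distribution_axioms_def fejer_measure_def
  by (auto intro!: prob_spaceI simp: emeasure_density nn_integral_fejer_density[OF assms])

lemma measure_fejer_measure_interval:
  assumes "positive_definite a" "a 0 = 1" "N > 0"
  shows "measure (fejer_measure a N) {-1<..8} = 1"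
proof -
  have "fejer_density a N \<theta> = 0" if "\<theta> \<notin> {-1<..8}" for \<theta>
    using that pi_less_4 by (auto simp: fejer_density_def indicator_def)
  then have "ennreal (fejer_density a N \<theta>) * indicator {-1<..8} \<theta> = ennreal (fejer_density a N \<theta>)" for \<theta>
    by (cases "\<theta> \<in> {-1<..8}") auto
  then have "emeasure (fejer_measure a N) {-1<..8} = 1"
    unfolding fejer_measure_def
    by (subst emeasure_density) (auto simp: nn_integral_fejer_density[OF assms])
  then show ?thesis by (simp add: measure_def)
qed

lemma tight_fejer_measure:
  assumes "positive_definite a" "a 0 = 1"
  shows "tight (\<lambda>N. fejer_measure a (Suc N))"
  unfolding tight_def
proof (intro conjI allI impI)
  show "real_distribution (fejer_measure a (Suc N))" for N
    using assms by (intro real_distribution_fejer_measure) auto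
  show "\<exists>b c. b < c \<and> (\<forall>N. 1 - e < measure (fejer_measure a (Suc N)) {b<..c})" if "e > 0" for e :: real
    using measure_fejer_measure_interval[OF assms] that by (intro exI[of _ "-1"] exI[of _ 8]) auto
qed

theorem herglotz:
  assumes a: "positive_definite a" "a 0 = 1"
  obtains L where "real_distribution L" "\<And>n::nat. (\<integral>\<theta>. cis (real n * \<theta>) \<partial>L) = a (int n)"
proof -
  let ?M = "\<lambda>N. fejer_measure a (Suc N)"
  obtain r L where r: "strict_mono (r :: nat \<Rightarrow> nat)" and L: "real_distribution L"
      and conv: "weak_conv_m (?M \<circ> id \<circ> r) L"
    using tight_imp_convergent_subsubsequence[OF tight_fejer_measure[OF a], of id]
    by (auto simp: strict_mono_def)
  have "(\<integral>\<theta>. cis (real n * \<theta>) \<partial>L) = a (int n)" for n :: nat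
  proof (rule LIMSEQ_unique)
    show "(\<lambda>k. \<integral>\<theta>. cis (real n * \<theta>) \<partial>((?M \<circ> id \<circ> r) k)) \<longlonglongrightarrow> (\<integral>\<theta>. cis (real n * \<theta>) \<partial>L)"
    proof (rule weak_conv_imp_integral_bdd_continuous_conv[OF _ L conv, where B = 1])
      have "continuous_on UNIV (\<lambda>\<theta>. cis (real n * \<theta>))" by (intro continuous_intros)
      then show "isCont (\<lambda>\<theta>. cis (real n * \<theta>)) \<theta>" for \<theta>
        by (simp add: continuous_on_eq_continuous_at)
    qed (auto intro: real_distribution_fejer_measure[OF a])
    show "(\<lambda>k. \<integral>\<theta>. cis (real n * \<theta>) \<partial>((?M \<circ> id \<circ> r) k)) \<longlonglongrightarrow> a (int n)"
      using LIMSEQ_subseq_LIMSEQ[OF tendsto_integral_cis_fejer_measure[OF a(1)] r]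
      by (simp add: o_def)
  qed
  then show ?thesis using that L by blast
qed

section \<open>Transfer from the circle to the line\<close>

lemma cesaro_cis_tendsto_indicator:
  "(\<lambda>N. (\<Sum>n<N. cis (real n * \<theta>)) / of_nat N) \<longlonglongrightarrow> indicator {\<theta>. cis \<theta> = 1} \<theta>"
proof (cases "cis \<theta> = 1")
  case True
  have "(\<lambda>N. of_nat (Suc N) / of_nat (Suc N) :: complex) \<longlonglongrightarrow> 1"
    by (simp del: of_nat_Suc)
  then show ?thesis using True
    by (subst filterlim_sequentially_Suc[symmetric])
      (simp add: Complex.DeMoivre[symmetric] indicator_def del: of_nat_Suc sum.lessThan_Suc)
next
  case False
  have "cmod ((\<Sum>n<N. cis \<theta> ^ n) / of_nat N) \<le> (2 / cmod (cis \<theta> - 1)) / real N" for N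
  proof -
    have "cmod (\<Sum>n<N. cis \<theta> ^ n) = cmod (cis \<theta> ^ N - 1) / cmod (cis \<theta> - 1)"
      using geometric_sum[OF False, of N] by (simp add: norm_divide)
    also have "\<dots> \<le> (cmod (cis \<theta> ^ N) + cmod 1) / cmod (cis \<theta> - 1)"
      by (intro divide_right_mono norm_triangle_ineq4) auto
    finally have "cmod (\<Sum>n<N. cis \<theta> ^ n) \<le> 2 / cmod (cis \<theta> - 1)" by (simp add: norm_power)
    from divide_right_mono[OF this, of "real N"] show ?thesis by (simp add: norm_divide)
  qed
  then have "(\<lambda>N. (\<Sum>n<N. cis \<theta> ^ n) / of_nat N) \<longlonglongrightarrow> 0"
    by (intro Lim_null_comparison[OF _ lim_const_over_n[of "2 / cmod (cis \<theta> - 1)"]]) auto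
  then show ?thesis using False by (simp add: Complex.DeMoivre[symmetric])
qed

lemma cesaro_moments_tendsto_measure_cis_eq_1:
  assumes L: "finite_measure L" "sets L = sets borel"
  shows "(\<lambda>N. (\<Sum>n<N. \<integral>\<theta>. cis (real n * \<theta>) \<partial>L) / of_nat N) \<longlonglongrightarrow> complex_of_real (measure L {\<theta>. cis \<theta> = 1})"
proof -
  interpret finite_measure L by fact
  note [measurable_cong] = L(2)
  have "integrable L (\<lambda>\<theta>. cis (real n * \<theta>))" for n
    by (intro integrable_const_bound[where B = 1]) auto
  then have "(\<Sum>n<N. \<integral>\<theta>. cis (real n * \<theta>) \<partial>L) / of_nat N
      = (\<integral>\<theta>. (\<Sum>n<N. cis (real n * \<theta>)) / of_nat N \<partial>L)" for N by simp
  moreover have "(\<lambda>N. \<integral>\<theta>. (\<Sum>n<N. cis (real n * \<theta>)) / of_nat N \<partial>L)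
      \<longlonglongrightarrow> (\<integral>\<theta>. indicator {\<theta>. cis \<theta> = 1} \<theta> \<partial>L)"
  proof (rule integral_dominated_convergence[where w = "\<lambda>_. 1"])
    have "cmod (\<Sum>n<N. cis (real n * \<theta>)) \<le> (\<Sum>n<N. 1)" for N \<theta>
      by (rule order_trans[OF norm_sum]) simp
    then show "AE \<theta> in L. cmod ((\<Sum>n<N. cis (real n * \<theta>)) / of_nat N) \<le> 1" for N
      by (auto simp: norm_divide divide_le_eq_1)
  qed (use cesaro_cis_tendsto_indicator in auto)
  moreover have "(\<integral>\<theta>. (indicator {\<theta>. cis \<theta> = 1} \<theta> :: complex) \<partial>L) = of_real (measure L {\<theta>. cis \<theta> = 1})"
    using integral_complex_of_real[of L "indicator {\<theta>. cis \<theta> = 1}"] sets_eq_imp_space_eq[OF L(2)]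
    by (simp add: of_real_indicator)
  ultimately show ?thesis by (simp only:)
qed

lemma cayley_minus_cot:
  assumes "cis \<theta> \<noteq> 1"
  shows "cayley (- cot (\<theta> / 2)) = cis \<theta>"
proof -
  define z where "z = cis (\<theta> / 2)"
  have z2: "z * z = cis \<theta>" by (simp add: z_def cis_mult)
  have "sin (\<theta> / 2) \<noteq> 0"
  proof
    assume "sin (\<theta> / 2) = 0"
    then have "cos (\<theta> / 2) = 1 \<or> cos (\<theta> / 2) = - 1"
      using sin_cos_squared_add[of "\<theta> / 2"] by (simp add: power2_eq_1_iff)
    then have "z = 1 \<or> z = - 1" using \<open>sin (\<theta> / 2) = 0\<close> by (auto simp: z_def complex_eq_iff)
    then show False using z2 assms by auto
  qed
  then have "of_real (- cot (\<theta> / 2)) - \<i> = - z / of_real (sin (\<theta> / 2))"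
    "of_real (- cot (\<theta> / 2)) + \<i> = - cnj z / of_real (sin (\<theta> / 2))"
    by (simp_all add: z_def cot_def complex_eq_iff)
  then have "cayley (- cot (\<theta> / 2)) = z / cnj z"
    using \<open>sin (\<theta> / 2) \<noteq> 0\<close> by (simp add: cayley_def)
  also have "\<dots> = z * z" by (simp add: z_def cis_cnj cis_divide cis_mult)
  finally show ?thesis by (simp add: z2)
qed

lemma borel_measurable_minus_cot_half [measurable]: "(\<lambda>\<theta>::real. - cot (\<theta> / 2)) \<in> borel_measurable borel"
  unfolding cot_def by measurable

lemma integral_cayley_powi_distr_minus_cot:
  assumes sets: "sets L = sets borel" and ae: "AE \<theta> in L. cis \<theta> \<noteq> 1"
  shows "(\<integral>s. cayley s powi n \<partial>distr L borel (\<lambda>\<theta>. - cot (\<theta> / 2))) = (\<integral>\<theta>. cis (of_int n * \<theta>) \<partial>L)"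
proof -
  note [measurable_cong] = sets
  note [measurable] = borel_measurable_bounded_borel[OF bounded_borel_cayley_powi[of n]]
  have "(\<integral>s. cayley s powi n \<partial>distr L borel (\<lambda>\<theta>. - cot (\<theta> / 2)))
      = (\<integral>\<theta>. cayley (- cot (\<theta> / 2)) powi n \<partial>L)"
    by (intro integral_distr) measurable
  also have "\<dots> = (\<integral>\<theta>. cis (of_int n * \<theta>) \<partial>L)"
  proof (rule integral_cong_AE)
    show "AE \<theta> in L. cayley (- cot (\<theta> / 2)) powi n = cis (of_int n * \<theta>)"
      using ae by eventually_elim (simp add: cayley_minus_cot cis_power_int)
    show "(\<lambda>\<theta>. cayley (- cot (\<theta> / 2)) powi n) \<in> borel_measurable L"
      by (rule measurable_compose[of "\<lambda>\<theta>. - cot (\<theta> / 2)" L borel "\<lambda>s. cayley s powi n"]) measurable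
  qed measurable
  finally show ?thesis .
qed

section \<open>Unitary operators\<close>

lemma int_iff_induct [case_names zero step]:
  assumes "P (0::int)" and step: "\<And>n. P (n + 1) \<longleftrightarrow> P n"
  shows "P n"
proof (induction n rule: int_induct[where k = 0])
  case (step2 i)
  then show ?case using step[of "i - 1"] by simp
qed (use assms in auto)

locale unitary_operator =
  fixes U :: "'a::chilbert_space \<Rightarrow> 'a"
  assumes U_add: "U (x + y) = U x + U y"
    and U_scaleC: "U (c *\<^sub>C x) = c *\<^sub>C U x"
    and cinner_U_U: "cinner (U x) (U y) = cinner x y"
    and surj_U: "surj U"
begin

lemma U_diff: "U (x - y) = U x - U y"
  using U_add[of x "- y"] U_scaleC[of "-1" y] by (simp add: scaleC_minus_left scaleC_one)

lemma inj_U: "inj U"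
proof (rule injI)
  fix x y assume "U x = U y"
  then have "cinner (U (x - y)) (U (x - y)) = 0" by (simp add: U_diff)
  then show "x = y" by (simp add: cinner_U_U cinner_self_eq_zero)
qed

definition U_pow :: "int \<Rightarrow> 'a \<Rightarrow> 'a" where
  "U_pow n = (if 0 \<le> n then U ^^ nat n else inv U ^^ nat (- n))"

lemma U_pow_0 [simp]: "U_pow 0 x = x"
  and U_pow_1 [simp]: "U_pow 1 x = U x"
  by (simp_all add: U_pow_def)

lemma U_pow_plus_1: "U_pow (n + 1) x = U (U_pow n x)"
proof (cases n rule: int_cases)
  case (nonneg k)
  then have "nat (n + 1) = Suc k" by simp
  then show ?thesis using nonneg by (simp add: U_pow_def)
next
  case (neg k)
  then have "nat (- n) = Suc k" "nat (- (n + 1)) = k" by simp_all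
  then show ?thesis using neg by (auto simp: U_pow_def surj_U surj_f_inv_f simp del: neg)
qed

lemma U_pow_U_pow: "U_pow m (U_pow n x) = U_pow (m + n) x"
proof (induction m rule: int_iff_induct)
  case (step m)
  have "U_pow (m + 1 + n) x = U (U_pow (m + n) x)"
    using U_pow_plus_1[of "m + n"] by (simp add: add_ac)
  then show ?case using inj_U by (simp add: U_pow_plus_1 inj_eq)
qed simp

lemma U_pow_add: "U_pow n (x + y) = U_pow n x + U_pow n y"
  by (induction n rule: int_iff_induct) (simp_all add: U_pow_plus_1 inj_eq[OF inj_U] flip: U_add)

lemma U_pow_scaleC: "U_pow n (c *\<^sub>C x) = c *\<^sub>C U_pow n x"
  by (induction n rule: int_iff_induct) (simp_all add: U_pow_plus_1 inj_eq[OF inj_U] flip: U_scaleC)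

lemma U_pow_diff: "U_pow n (x - y) = U_pow n x - U_pow n y"
  by (induction n rule: int_iff_induct) (simp_all add: U_pow_plus_1 inj_eq[OF inj_U] flip: U_diff)

lemma cinner_U_pow_U_pow: "cinner (U_pow n x) (U_pow n y) = cinner x y"
  by (induction n rule: int_iff_induct) (simp_all add: U_pow_plus_1 cinner_U_U)

lemma cinner_U_pow_left: "cinner (U_pow n x) y = cinner x (U_pow (- n) y)"
  using cinner_U_pow_U_pow[of "- n" "U_pow n x" y] by (simp add: U_pow_U_pow)

lemma norm_U_pow [simp]: "norm (U_pow n x) = norm x"
  by (simp add: norm_eq_sqrt_cinner cinner_U_pow_U_pow)

lemma positive_definite_cinner_U_pow: "positive_definite (\<lambda>n. cinner (U_pow n x) x)"
  unfolding positive_definite_def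
proof (intro allI)
  fix N :: nat and c :: "nat \<Rightarrow> complex"
  have "cinner (U_pow (int j) x) (U_pow (int k) x) = cinner (U_pow (int j - int k) x) x" for j k
    using cinner_U_pow_left[of "- int k" "U_pow (int j) x" x] by (simp add: U_pow_U_pow)
  then have "(\<Sum>j<N. \<Sum>k<N. c j * cnj (c k) * cinner (U_pow (int j - int k) x) x)
      = cinner (\<Sum>j<N. c j *\<^sub>C U_pow (int j) x) (\<Sum>k<N. c k *\<^sub>C U_pow (int k) x)"
    by (simp add: cinner_sum_left cinner_sum_right cinner_simps sum_distrib_left mult_ac)
      (rule sum.swap)
  then show "(\<Sum>j<N. \<Sum>k<N. c j * cnj (c k) * cinner (U_pow (int j - int k) x) x) \<in> \<real>\<^sub>\<ge>\<^sub>0"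
    by (simp only: cinner_self nonneg_Reals_of_real_iff zero_le_power2)
qed

definition cesaro_mean :: "nat \<Rightarrow> 'a \<Rightarrow> 'a" where
  "cesaro_mean N x = (1 / real N) *\<^sub>R (\<Sum>n<N. U_pow (int n) x)"

lemma norm_cesaro_mean_le: "norm (cesaro_mean N x) \<le> norm x"
proof -
  have "norm (\<Sum>n<N. U_pow (int n) x) \<le> (\<Sum>n<N. norm x)"
    by (rule order_trans[OF norm_sum]) simp
  then show ?thesis by (cases "N = 0") (simp_all add: cesaro_mean_def field_simps)
qed

lemma cesaro_mean_diff: "cesaro_mean N (x - y) = cesaro_mean N x - cesaro_mean N y"
  by (simp add: cesaro_mean_def U_pow_diff sum_subtractf scaleR_diff_right)

lemma norm_cesaro_mean_coboundary_le: "norm (cesaro_mean N (w - U w)) \<le> 2 * norm w / real N"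
proof -
  have telescope: "(\<Sum>n<N. U_pow (int n) (w - U w)) = w - U_pow (int N) w"
  proof (induction N)
    case (Suc N)
    have "U_pow (int N) (U w) = U_pow (int (Suc N)) w"
      using U_pow_U_pow[of "int N" 1 w] by (simp add: add.commute)
    then show ?case using Suc by (simp add: U_pow_diff)
  qed simp
  have "norm (w - U_pow (int N) w) \<le> 2 * norm w"
    using norm_triangle_ineq4[of w "U_pow (int N) w"] by simp
  then show ?thesis unfolding cesaro_mean_def telescope by (simp add: divide_right_mono)
qed

end

locale unitary_operator_dense = unitary_operator +
  assumes dense: "closure (range (\<lambda>w. w - U w)) = UNIV"
begin

theorem mean_ergodic: "(\<lambda>N. cesaro_mean N x) \<longlonglongrightarrow> 0"
proof (rule tendstoI)
  fix e :: real assume e: "e > 0"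
  have "x \<in> closure (range (\<lambda>w. w - U w))" using dense by simp
  then obtain w where w: "norm (x - (w - U w)) < e"
    using e by (auto simp: closure_approachable dist_norm norm_minus_commute)
  have "norm (cesaro_mean N x) \<le> 2 * norm w / real N + norm (x - (w - U w))" for N
    using norm_triangle_ineq[of "cesaro_mean N (w - U w)" "cesaro_mean N (x - (w - U w))"]
      norm_cesaro_mean_coboundary_le[of N w] norm_cesaro_mean_le[of N "x - (w - U w)"]
    by (simp add: cesaro_mean_diff)
  moreover have "(\<lambda>N. 2 * norm w / real N + norm (x - (w - U w))) \<longlonglongrightarrow> 0 + norm (x - (w - U w))"
    by (intro tendsto_intros lim_const_over_n)
  then have "\<forall>\<^sub>F N in sequentially. 2 * norm w / real N + norm (x - (w - U w)) < e"
    using w by (intro order_tendstoD(2)) auto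
  ultimately show "\<forall>\<^sub>F N in sequentially. dist (cesaro_mean N x) 0 < e"
    by (auto elim!: eventually_mono simp: dist_norm intro: le_less_trans)
qed

section \<open>Scalar spectral measures of a unitary operator\<close>

lemma circle_measure_exists:
  assumes x: "norm x = 1"
  obtains L where "real_distribution L" "\<And>n::int. (\<integral>\<theta>. cis (of_int n * \<theta>) \<partial>L) = cinner (U_pow n x) x"
proof -
  obtain L where L: "real_distribution L"
    and moments: "\<And>n::nat. (\<integral>\<theta>. cis (real n * \<theta>) \<partial>L) = cinner (U_pow (int n) x) x"
    using herglotz[OF positive_definite_cinner_U_pow[of x]] x by (auto simp: cinner_self)
  have "(\<integral>\<theta>. cis (of_int n * \<theta>) \<partial>L) = cinner (U_pow n x) x" for n :: int
  proof (cases n rule: int_cases2)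
    case (nonneg m)
    then show ?thesis using moments[of m] by simp
  next
    case (nonpos m)
    then have "(\<integral>\<theta>. cis (of_int n * \<theta>) \<partial>L) = (\<integral>\<theta>. cnj (cis (real m * \<theta>)) \<partial>L)"
      by (simp add: cis_cnj)
    also have "\<dots> = cnj (cinner (U_pow (int m) x) x)" by (simp add: moments)
    also have "\<dots> = cinner x (U_pow (int m) x)" by (metis cinner_conj_commute)
    finally show ?thesis using cinner_U_pow_left[of n x x] nonpos by simp
  qed
  then show ?thesis using that L by blast
qed

text \<open>By the mean ergodic theorem the measure on the circle has no atom at \<open>1\<close>, the point that
  corresponds to infinity on the line.\<close>
lemma scalar_measure_exists_unit:
  assumes x: "norm x = 1"
  obtains M where "prob_space M" "sets M = sets borel"
    "\<And>n::int. (\<integral>s. cayley s powi n \<partial>M) = cinner (U_pow n x) x"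
proof -
  obtain L where "real_distribution L"
    and moments: "\<And>n::int. (\<integral>\<theta>. cis (of_int n * \<theta>) \<partial>L) = cinner (U_pow n x) x"
    using circle_measure_exists[OF x] by blast
  then interpret real_distribution L by simp
  have "(\<Sum>n<N. \<integral>\<theta>. cis (real n * \<theta>) \<partial>L) / of_nat N = cinner (cesaro_mean N x) x" for N
    using moments[of "int _"]
    by (simp add: cesaro_mean_def cinner_sum_left cinner_simps scaleR_scaleC)
  moreover have "(\<lambda>N. cinner (cesaro_mean N x) x) \<longlonglongrightarrow> cinner 0 x"
    by (intro tendsto_cinner_left mean_ergodic)
  ultimately have "complex_of_real (measure L {\<theta>. cis \<theta> = 1}) = 0"
    by (intro LIMSEQ_unique[OF cesaro_moments_tendsto_measure_cis_eq_1[OF finite_measure_axioms events_eq_borel]]) simp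
  then have "AE \<theta> in L. cis \<theta> \<noteq> 1"
    by (intro AE_I[where N = "{\<theta>. cis \<theta> = 1}"]) (auto simp: emeasure_eq_measure)
  then have "(\<integral>s. cayley s powi n \<partial>distr L borel (\<lambda>\<theta>. - cot (\<theta> / 2))) = cinner (U_pow n x) x" for n
    by (simp add: integral_cayley_powi_distr_minus_cot moments)
  moreover have "prob_space (distr L borel (\<lambda>\<theta>. - cot (\<theta> / 2)))"
    by (rule prob_space_distr) measurable
  ultimately show ?thesis using that by simp
qed

lemma scalar_measure_exists:
  "\<exists>M. finite_measure M \<and> sets M = sets borel \<and>
     (\<forall>n::int. (\<integral>s. cayley s powi n \<partial>M) = cinner (U_pow n x) x)"
proof (cases "x = 0")
  case True
  have "U_pow n 0 = 0" for n using U_pow_diff[of n 0 0] by simp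
  then show ?thesis using True
    by (intro exI[of _ "null_measure borel"])
       (auto intro!: finite_measureI simp: integral_null_measure)
next
  case False
  then obtain M where M: "prob_space M" "sets M = sets borel"
    and moments: "\<And>n::int. (\<integral>s. cayley s powi n \<partial>M) = cinner (U_pow n (sgn x)) (sgn x)"
    using scalar_measure_exists_unit[of "sgn x"] by (metis norm_sgn)
  interpret prob_space M by fact
  note [measurable_cong] = M(2)
  note [measurable] = borel_measurable_bounded_borel[OF bounded_borel_cayley_powi]
  define N where "N = density M (\<lambda>_. ennreal ((norm x)\<^sup>2))"
  have "emeasure N (space N) = ennreal ((norm x)\<^sup>2)"
    unfolding N_def by (simp add: emeasure_density emeasure_space_1)
  then have "finite_measure N" by (intro finite_measureI) simp
  moreover have "sets N = sets borel" by (simp add: N_def M)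
  moreover have "(\<integral>s. cayley s powi n \<partial>N) = cinner (U_pow n x) x" for n
  proof -
    have "(\<integral>s. cayley s powi n \<partial>N) = (\<integral>s. (norm x)\<^sup>2 *\<^sub>R (cayley s powi n) \<partial>M)"
      unfolding N_def by (intro integral_density) auto
    also have "\<dots> = cinner (U_pow n (of_real (norm x) *\<^sub>C sgn x)) (of_real (norm x) *\<^sub>C sgn x)"
      by (simp add: moments scaleR_conv_of_real U_pow_scaleC cinner_simps power2_eq_square)
    finally show ?thesis by (simp only: scaleC_norm_sgn)
  qed
  ultimately show ?thesis by blast
qed

definition scalar_measure :: "'a \<Rightarrow> real measure" where
  "scalar_measure x = (SOME M. finite_measure M \<and> sets M = sets borel \<and>
     (\<forall>n::int. (\<integral>s. cayley s powi n \<partial>M) = cinner (U_pow n x) x))"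

lemma finite_scalar_measure: "finite_measure (scalar_measure x)"
  and sets_scalar_measure [measurable_cong, simp]: "sets (scalar_measure x) = sets borel"
  and moment_scalar_measure: "(\<integral>s. cayley s powi n \<partial>scalar_measure x) = cinner (U_pow n x) x"
  using someI_ex[OF scalar_measure_exists[of x]] unfolding scalar_measure_def by blast+

lemma space_scalar_measure [simp]: "space (scalar_measure x) = UNIV"
  using sets_eq_imp_space_eq[OF sets_scalar_measure[of x]] by simp

lemmas integrable_scalar_measure = integrable_bounded_borel[OF finite_scalar_measure sets_scalar_measure]
lemmas sigma_functional_scalar_measure = sigma_functional_integral[OF finite_scalar_measure sets_scalar_measure]

lemma measure_scalar_measure_UNIV: "measure (scalar_measure x) UNIV = (norm x)\<^sup>2"
proof -
  have "complex_of_real (measure (scalar_measure x) UNIV) = of_real ((norm x)\<^sup>2)"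
    using moment_scalar_measure[where n = 0, of x] by (simp add: cinner_self scaleR_conv_of_real)
  then show ?thesis by (simp only: of_real_eq_iff)
qed

lemma norm_integral_scalar_measure_le:
  assumes f: "bounded_borel f" and K: "\<And>s. cmod (f s) \<le> K"
  shows "cmod (\<integral>s. f s \<partial>scalar_measure x) \<le> K * (norm x)\<^sup>2"
proof -
  interpret finite_measure "scalar_measure x" by (rule finite_scalar_measure)
  have "cmod (\<integral>s. f s \<partial>scalar_measure x) \<le> (\<integral>s. cmod (f s) \<partial>scalar_measure x)" by simp
  also have "\<dots> \<le> (\<integral>s. K \<partial>scalar_measure x)"
    using integrable_scalar_measure[OF f] K by (intro integral_mono) auto
  finally show ?thesis by (simp add: measure_scalar_measure_UNIV mult.commute)
qed

section \<open>Functional calculus\<close>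

definition spectral_form :: "(real \<Rightarrow> complex) \<Rightarrow> 'a \<Rightarrow> 'a \<Rightarrow> complex" where
  "spectral_form f x y =
     (1/4) * (\<integral>s. f s \<partial>scalar_measure (x + y)) + (-1/4) * (\<integral>s. f s \<partial>scalar_measure (x - y))
     + (\<i>/4) * (\<integral>s. f s \<partial>scalar_measure (x + \<i> *\<^sub>C y))
     + (-\<i>/4) * (\<integral>s. f s \<partial>scalar_measure (x - \<i> *\<^sub>C y))"

lemma sigma_functional_spectral_form: "sigma_functional (\<lambda>f. spectral_form f x y)"
  unfolding spectral_form_def
  by (intro sigma_functional_add sigma_functional_cmult sigma_functional_scalar_measure)

lemma spectral_form_cayley_powi: "spectral_form (\<lambda>s. cayley s powi n) x y = cinner (U_pow n x) y"
  unfolding spectral_form_def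
  by (simp add: moment_scalar_measure U_pow_add U_pow_diff U_pow_scaleC cinner_simps field_simps)

lemma spectral_form_add_left:
  "bounded_borel f \<Longrightarrow> spectral_form f (x + x') y = spectral_form f x y + spectral_form f x' y"
  by (rule sigma_functional_eqI[of "\<lambda>f. spectral_form f (x + x') y"
        "\<lambda>f. spectral_form f x y + spectral_form f x' y"])
     (auto intro: sigma_functional_spectral_form sigma_functional_add
       simp: spectral_form_cayley_powi U_pow_add cinner_simps)

lemma spectral_form_scaleC_left:
  "bounded_borel f \<Longrightarrow> spectral_form f (c *\<^sub>C x) y = c * spectral_form f x y"
  by (rule sigma_functional_eqI[of "\<lambda>f. spectral_form f (c *\<^sub>C x) y" "\<lambda>f. c * spectral_form f x y"])
     (auto intro: sigma_functional_spectral_form sigma_functional_cmult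
       simp: spectral_form_cayley_powi U_pow_scaleC cinner_simps)

lemma cnj_spectral_form:
  "bounded_borel f \<Longrightarrow> cnj (spectral_form (\<lambda>s. cnj (f s)) x y) = spectral_form f y x"
proof (rule sigma_functional_eqI[of "\<lambda>f. cnj (spectral_form (\<lambda>s. cnj (f s)) x y)"])
  show "cnj (spectral_form (\<lambda>s. cnj (cayley s powi n)) x y) = spectral_form (\<lambda>s. cayley s powi n) y x" for n
    unfolding cnj_cayley_powi spectral_form_cayley_powi cinner_U_pow_left[of n y x]
    by (rule cinner_conj_commute[symmetric])
qed (auto intro: sigma_functional_spectral_form sigma_functional_cnj)

lemma spectral_form_self:
  "bounded_borel f \<Longrightarrow> spectral_form f x x = (\<integral>s. f s \<partial>scalar_measure x)"
  by (rule sigma_functional_eqI[of "\<lambda>f. spectral_form f x x" "\<lambda>f. \<integral>s. f s \<partial>scalar_measure x"])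
     (auto intro: sigma_functional_spectral_form sigma_functional_scalar_measure
       simp: spectral_form_cayley_powi moment_scalar_measure)

lemma spectral_form_mult_cayley_powi:
  "bounded_borel f \<Longrightarrow> spectral_form (\<lambda>s. f s * cayley s powi n) x y = spectral_form f x (U_pow (- n) y)"
proof (rule sigma_functional_eqI[of "\<lambda>f. spectral_form (\<lambda>s. f s * cayley s powi n) x y"
      "\<lambda>f. spectral_form f x (U_pow (- n) y)"])
  have "cinner (U_pow m x) (U_pow (- n) y) = cinner (U_pow (m + n) x) y" for m
    by (simp add: U_pow_U_pow add.commute flip: cinner_U_pow_left)
  then show "spectral_form (\<lambda>s. cayley s powi m * cayley s powi n) x y
      = spectral_form (\<lambda>s. cayley s powi m) x (U_pow (- n) y)" for m
    by (simp add: spectral_form_cayley_powi flip: power_int_add)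
qed (auto intro!: sigma_functional_spectral_form sigma_functional_mult)

lemma norm_spectral_form_le:
  assumes f: "bounded_borel f" and K: "\<And>s. cmod (f s) \<le> K"
  shows "cmod (spectral_form f x y) \<le> K * (1 + (norm y)\<^sup>2) * norm x"
proof -
  let ?n = "\<lambda>z. (norm z)\<^sup>2"
  have "cmod (spectral_form f (sgn x) y) \<le> (1/4) * (K * ?n (sgn x + y)) + (1/4) * (K * ?n (sgn x - y))
      + (1/4) * (K * ?n (sgn x + \<i> *\<^sub>C y)) + (1/4) * (K * ?n (sgn x - \<i> *\<^sub>C y))"
    unfolding spectral_form_def
    by (intro norm_triangle_mono; simp add: norm_mult norm_integral_scalar_measure_le[OF f K])
  also have "\<dots> = K / 4 * ((?n (sgn x + y) + ?n (sgn x - y)) + (?n (sgn x + \<i> *\<^sub>C y) + ?n (sgn x - \<i> *\<^sub>C y)))"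
    by (simp add: algebra_simps)
  also have "\<dots> = K * (?n (sgn x) + ?n y)"
    unfolding parallelogram_law by (simp add: norm_scaleC algebra_simps)
  also have "\<dots> \<le> K * (1 + ?n y)"
    using order_trans[OF norm_ge_zero K] by (intro mult_left_mono) (simp_all add: norm_sgn)
  finally have "norm x * cmod (spectral_form f (sgn x) y) \<le> norm x * (K * (1 + ?n y))"
    by (intro mult_left_mono) auto
  moreover have "spectral_form f x y = of_real (norm x) * spectral_form f (sgn x) y"
    by (metis scaleC_norm_sgn spectral_form_scaleC_left[OF f])
  ultimately show ?thesis by (simp add: norm_mult mult_ac)
qed

definition fun_calc :: "(real \<Rightarrow> complex) \<Rightarrow> 'a \<Rightarrow> 'a" where
  "fun_calc f x = (SOME w. \<forall>y. cinner w y = spectral_form f x y)"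

lemma cinner_fun_calc_left:
  assumes f: "bounded_borel f"
  shows "cinner (fun_calc f x) y = spectral_form f x y"
proof -
  note f' = bounded_borel_cnj[OF f]
  obtain K where K: "\<And>s. cmod (cnj (f s)) \<le> K" using f' by (auto simp: bounded_borel_def)
  interpret bounded_functional_on UNIV "\<lambda>y. spectral_form (\<lambda>s. cnj (f s)) y x" "K * (1 + (norm x)\<^sup>2)"
    by standard (simp_all add: csubspace_UNIV spectral_form_add_left[OF f'] spectral_form_scaleC_left[OF f']
        norm_spectral_form_le[OF f' K])
  obtain w where "\<And>y. spectral_form (\<lambda>s. cnj (f s)) y x = cinner y w"
    using riesz_representation by auto
  then have "\<forall>y. cinner w y = spectral_form f x y"
    using cnj_spectral_form[OF f] cinner_conj_commute by metis
  from someI[of "\<lambda>w. \<forall>y. cinner w y = spectral_form f x y", OF this]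
  show ?thesis by (simp add: fun_calc_def)
qed

lemma fun_calc_add_right:
  assumes "bounded_borel f" shows "fun_calc f (x + y) = fun_calc f x + fun_calc f y"
  by (rule cinner_ext_left)
     (simp add: cinner_fun_calc_left assms spectral_form_add_left cinner_simps)

lemma fun_calc_scaleC_right:
  assumes "bounded_borel f" shows "fun_calc f (c *\<^sub>C x) = c *\<^sub>C fun_calc f x"
  by (rule cinner_ext_left)
     (simp add: cinner_fun_calc_left assms spectral_form_scaleC_left cinner_simps)

lemma fun_calc_add:
  assumes "bounded_borel f" "bounded_borel g"
  shows "fun_calc (\<lambda>s. f s + g s) x = fun_calc f x + fun_calc g x"
  by (rule cinner_ext_left)
     (simp add: cinner_fun_calc_left assms bounded_borel_add cinner_simps
        sigma_functional_add_arg[OF sigma_functional_spectral_form])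

lemma fun_calc_diff:
  assumes "bounded_borel f" "bounded_borel g"
  shows "fun_calc (\<lambda>s. f s - g s) x = fun_calc f x - fun_calc g x"
  using fun_calc_add[OF bounded_borel_diff[OF assms] assms(2), of x] by simp

lemma fun_calc_cayley_powi: "fun_calc (\<lambda>s. cayley s powi n) x = U_pow n x"
  by (rule cinner_ext_left)
     (simp add: cinner_fun_calc_left bounded_borel_cayley_powi spectral_form_cayley_powi)

lemma fun_calc_1: "fun_calc (\<lambda>s. 1) x = x"
  and fun_calc_cayley: "fun_calc cayley x = U x"
  using fun_calc_cayley_powi[of 0 x] fun_calc_cayley_powi[of 1 x] by simp_all

lemma fun_calc_0: "fun_calc (\<lambda>s. 0) x = 0"
  using fun_calc_diff[of "\<lambda>s. 1" "\<lambda>s. 1" x] by simp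

lemma fun_calc_fun_calc:
  assumes f: "bounded_borel f" and g: "bounded_borel g"
  shows "fun_calc f (fun_calc g x) = fun_calc (\<lambda>s. f s * g s) x"
proof (rule cinner_ext_left)
  fix y
  have "spectral_form (\<lambda>s. f s * g s) x y = spectral_form f (fun_calc g x) y"
  proof (rule sigma_functional_eqI[OF _ _ _ f])
    fix n :: int
    have "(\<lambda>s. cayley s powi n * g s) = (\<lambda>s. g s * cayley s powi n)" by (simp add: mult.commute)
    then have "spectral_form (\<lambda>s. cayley s powi n * g s) x y = cinner (fun_calc g x) (U_pow (- n) y)"
      by (simp add: spectral_form_mult_cayley_powi[OF g] cinner_fun_calc_left[OF g])
    then show "spectral_form (\<lambda>s. cayley s powi n * g s) x y = spectral_form (\<lambda>s. cayley s powi n) (fun_calc g x) y"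
      by (simp add: spectral_form_cayley_powi cinner_U_pow_left)
  qed (auto intro!: sigma_functional_spectral_form sigma_functional_mult g)
  then show "cinner (fun_calc f (fun_calc g x)) y = cinner (fun_calc (\<lambda>s. f s * g s) x) y"
    by (simp add: cinner_fun_calc_left f g bounded_borel_mult)
qed

lemma cinner_fun_calc_right:
  assumes f: "bounded_borel f"
  shows "cinner x (fun_calc f y) = cinner (fun_calc (\<lambda>s. cnj (f s)) x) y"
proof -
  have "cinner x (fun_calc f y) = cnj (spectral_form f y x)"
    by (metis cinner_fun_calc_left[OF f] cinner_conj_commute)
  also have "\<dots> = spectral_form (\<lambda>s. cnj (f s)) x y"
    using cnj_spectral_form[OF bounded_borel_cnj[OF f], of y x] by simp
  finally show ?thesis by (simp add: cinner_fun_calc_left bounded_borel_cnj f)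
qed

lemma cinner_fun_calc_fun_calc:
  assumes f: "bounded_borel f" and g: "bounded_borel g"
  shows "cinner (fun_calc f x) (fun_calc g x) = (\<integral>s. cnj (g s) * f s \<partial>scalar_measure x)"
  using f g
  by (simp add: cinner_fun_calc_right fun_calc_fun_calc cinner_fun_calc_left spectral_form_self
      bounded_borel_mult bounded_borel_cnj)

lemma norm_fun_calc_sq:
  assumes f: "bounded_borel f"
  shows "(norm (fun_calc f x))\<^sup>2 = (\<integral>s. (cmod (f s))\<^sup>2 \<partial>scalar_measure x)"
proof -
  have "complex_of_real ((norm (fun_calc f x))\<^sup>2) = (\<integral>s. cnj (f s) * f s \<partial>scalar_measure x)"
    by (simp only: cinner_self[symmetric] cinner_fun_calc_fun_calc[OF f f])
  also have "\<dots> = (\<integral>s. complex_of_real ((cmod (f s))\<^sup>2) \<partial>scalar_measure x)"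
    by (simp add: complex_norm_square mult.commute del: of_real_power)
  finally show ?thesis by (simp only: integral_complex_of_real of_real_eq_iff)
qed

lemma fun_calc_tendsto:
  assumes F: "\<And>n. F n \<in> borel_measurable borel" "\<And>n s. cmod (F n s) \<le> K"
    and lim: "\<And>s. (\<lambda>n. F n s) \<longlonglongrightarrow> f s"
  shows "(\<lambda>n. fun_calc (F n) x) \<longlonglongrightarrow> fun_calc f x"
proof (rule tendsto_if_norm_diff_sq_tendsto_0)
  interpret finite_measure "scalar_measure x" by (rule finite_scalar_measure)
  have K: "cmod (f s) \<le> K" for s
    by (rule Lim_norm_ubound[OF _ lim[of s]]) (use F in auto)
  have [measurable]: "f \<in> borel_measurable borel"
    by (rule borel_measurable_LIMSEQ_metric[of F]) (use F lim in auto)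
  note [measurable] = F(1)
  have bounded: "bounded_borel (F n)" "bounded_borel f" for n
    using F K by (auto intro!: bounded_borelI[where K = K])
  have "(\<lambda>n. \<integral>s. (cmod (F n s - f s))\<^sup>2 \<partial>scalar_measure x) \<longlonglongrightarrow> (\<integral>s. 0 \<partial>scalar_measure x)"
  proof (rule integral_dominated_convergence[where w = "\<lambda>_. (2 * K)\<^sup>2"])
    show "AE s in scalar_measure x. (\<lambda>n. (cmod (F n s - f s))\<^sup>2) \<longlonglongrightarrow> 0"
      using lim by (intro AE_I2 tendsto_null_power tendsto_norm_zero) (auto simp: LIM_zero)
    have "(cmod (F n s - f s))\<^sup>2 \<le> (2 * K)\<^sup>2" for n s
      using norm_triangle_ineq4[of "F n s" "f s"] F(2)[of n s] K[of s] by (intro power_mono) auto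
    then show "AE s in scalar_measure x. norm ((cmod (F n s - f s))\<^sup>2) \<le> (2 * K)\<^sup>2" for n
      by simp
  qed auto
  then show "(\<lambda>n. (norm (fun_calc (F n) x - fun_calc f x))\<^sup>2) \<longlonglongrightarrow> 0"
    using bounded by (simp add: norm_fun_calc_sq bounded_borel_diff flip: fun_calc_diff)
qed

definition spec_proj :: "real set \<Rightarrow> 'a \<Rightarrow> 'a" where
  "spec_proj B = fun_calc (indicator B)"

lemma orth_proj_spec_proj:
  assumes B: "B \<in> sets borel" shows "orth_proj (spec_proj B)"
proof -
  note b = bounded_borel_indicator[OF B]
  have "(\<lambda>s. indicator B s * indicator B s) = (indicator B :: real \<Rightarrow> complex)"
    and "(\<lambda>s. cnj (indicator B s)) = indicator B" by (auto simp: indicator_def)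
  then show ?thesis
    unfolding orth_proj_def spec_proj_def
    by (simp add: fun_calc_add_right[OF b] fun_calc_scaleC_right[OF b] fun_calc_fun_calc[OF b b]
        cinner_fun_calc_right[OF b])
qed

lemma spec_proj_Int:
  assumes "B \<in> sets borel" "C \<in> sets borel"
  shows "spec_proj (B \<inter> C) = spec_proj B \<circ> spec_proj C"
  using assms by (auto simp: spec_proj_def fun_calc_fun_calc bounded_borel_indicator fun_eq_iff
      simp flip: indicator_inter_arith intro!: arg_cong2[where f = fun_calc])

lemma spec_proj_UNIV: "spec_proj UNIV = id"
proof -
  have "indicator UNIV = (\<lambda>s::real. 1::complex)" by auto
  then show ?thesis by (auto simp: spec_proj_def fun_calc_1)
qed

lemma spec_proj_countably_additive:
  assumes F: "range F \<subseteq> sets borel" and disj: "disjoint_family F"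
  shows "(\<lambda>n. \<Sum>i<n. spec_proj (F i) x) \<longlonglongrightarrow> spec_proj (\<Union>i. F i) x"
proof -
  have Fi: "F i \<in> sets borel" for i using F by auto
  have sum: "(\<Sum>i<n. spec_proj (F i) x) = fun_calc (\<lambda>s. \<Sum>i<n. indicator (F i) s) x" for n
    using Fi by (induction n)
      (simp_all add: fun_calc_0 spec_proj_def fun_calc_add bounded_borel_sum bounded_borel_indicator)
  show ?thesis
    unfolding sum unfolding spec_proj_def sum_indicator_disjoint_family[OF disj]
  proof (rule fun_calc_tendsto[where K = 1])
    show "(indicator (\<Union>i<n. F i) :: real \<Rightarrow> complex) \<in> borel_measurable borel" for n
      using Fi by (intro borel_measurable_indicator) auto
    show "cmod (indicator (\<Union>i<n. F i) s) \<le> 1" for n s by (simp add: indicator_def)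
  qed (rule LIMSEQ_indicator_UN)
qed

lemma norm_spec_proj_sq:
  assumes B: "B \<in> sets borel" shows "(norm (spec_proj B x))\<^sup>2 = measure (scalar_measure x) B"
proof -
  have "(norm (spec_proj B x))\<^sup>2 = (\<integral>s. indicator B s \<partial>scalar_measure x)"
    unfolding spec_proj_def norm_fun_calc_sq[OF bounded_borel_indicator[OF B]]
    by (intro Bochner_Integration.integral_cong) (auto simp: indicator_def)
  then show ?thesis using B by simp
qed

lemma spectral_scalar_spec_proj: "spectral_scalar spec_proj x = scalar_measure x"
proof -
  interpret finite_measure "scalar_measure x" by (rule finite_scalar_measure)
  have "scalar_measure x = measure_of UNIV (sets borel) (emeasure (scalar_measure x))"
    using measure_of_of_measure[of "scalar_measure x"] by simp
  also have "\<dots> = spectral_scalar spec_proj x"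
    unfolding spectral_scalar_def
    by (rule measure_of_eq) (auto simp: norm_spec_proj_sq emeasure_eq_measure
        sets.sigma_sets_eq[of borel, simplified])
  finally show ?thesis by simp
qed

lemma scalar_measure_fun_calc:
  assumes f: "bounded_borel f"
  shows "scalar_measure (fun_calc f x) = density (scalar_measure x) (\<lambda>s. ennreal ((cmod (f s))\<^sup>2))"
proof (rule measure_eqI)
  fix B assume "B \<in> sets (scalar_measure (fun_calc f x))"
  then have B [measurable]: "B \<in> sets borel" by simp
  note [measurable] = borel_measurable_bounded_borel[OF f]
  interpret finite_measure "scalar_measure (fun_calc f x)" by (rule finite_scalar_measure)
  define g where "g s = indicator B s * f s" for s
  have g: "bounded_borel g"
    unfolding g_def by (intro bounded_borel_mult bounded_borel_indicator B f)
  have "measure (scalar_measure (fun_calc f x)) B = (norm (fun_calc g x))\<^sup>2"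
    unfolding g_def using f B
    by (simp add: spec_proj_def fun_calc_fun_calc bounded_borel_indicator flip: norm_spec_proj_sq)
  also have "\<dots> = (\<integral>s. (cmod (g s))\<^sup>2 \<partial>scalar_measure x)" by (rule norm_fun_calc_sq[OF g])
  finally have "emeasure (scalar_measure (fun_calc f x)) B = ennreal (\<integral>s. (cmod (g s))\<^sup>2 \<partial>scalar_measure x)"
    by (simp add: emeasure_eq_measure)
  also have "\<dots> = (\<integral>\<^sup>+s. ennreal ((cmod (g s))\<^sup>2) \<partial>scalar_measure x)"
  proof (rule nn_integral_eq_integral[symmetric])
    have "bounded_borel (\<lambda>s. cnj (g s) * g s)" by (intro bounded_borel_mult bounded_borel_cnj g)
    then have "integrable (scalar_measure x) (\<lambda>s. complex_of_real ((cmod (g s))\<^sup>2))"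
      using integrable_scalar_measure
      by (simp add: complex_norm_square mult.commute del: of_real_power)
    then show "integrable (scalar_measure x) (\<lambda>s. (cmod (g s))\<^sup>2)"
      by (simp only: complex_of_real_integrable_eq)
  qed simp
  also have "\<dots> = (\<integral>\<^sup>+s. ennreal ((cmod (f s))\<^sup>2) * indicator B s \<partial>scalar_measure x)"
    by (intro nn_integral_cong) (auto simp: g_def indicator_def)
  finally show "emeasure (scalar_measure (fun_calc f x)) B
      = emeasure (density (scalar_measure x) (\<lambda>s. ennreal ((cmod (f s))\<^sup>2))) B"
    by (simp add: emeasure_density)
qed simp

lemma
  shows diff_U_eq_fun_calc: "w - U w = fun_calc (\<lambda>s. 1 - cayley s) w"
    and add_U_eq_fun_calc: "w + U w = fun_calc (\<lambda>s. 1 + cayley s) w"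
  by (simp_all add: fun_calc_diff fun_calc_add bounded_borel_cayley fun_calc_1 fun_calc_cayley)

lemma second_moment_diff_U: "(\<integral>\<^sup>+s. ennreal (s\<^sup>2) \<partial>scalar_measure (w - U w)) < \<infinity>"
proof -
  interpret finite_measure "scalar_measure w" by (rule finite_scalar_measure)
  note [measurable] = borel_measurable_bounded_borel[OF bounded_borel_cayley]
  have "bounded_borel (\<lambda>s. 1 - cayley s)"
    by (intro bounded_borel_diff bounded_borel_const bounded_borel_cayley)
  then have "(\<integral>\<^sup>+s. ennreal (s\<^sup>2) \<partial>scalar_measure (w - U w))
      = (\<integral>\<^sup>+s. ennreal ((cmod (1 - cayley s))\<^sup>2) * ennreal (s\<^sup>2) \<partial>scalar_measure w)"
    unfolding diff_U_eq_fun_calc by (simp add: scalar_measure_fun_calc nn_integral_density)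
  also have "\<dots> \<le> (\<integral>\<^sup>+s. ennreal (2\<^sup>2) \<partial>scalar_measure w)"
  proof (intro nn_integral_mono)
    fix s :: real
    have "\<bar>s\<bar> * cmod (1 - cayley s) = cmod (1 + cayley s)"
      using arg_cong[OF of_real_mult_one_minus_cayley[of s], of cmod] by (simp add: norm_mult)
    also have "\<dots> \<le> 2" using norm_triangle_ineq[of 1 "cayley s"] by simp
    finally have "(\<bar>s\<bar> * cmod (1 - cayley s))\<^sup>2 \<le> 2\<^sup>2" by (intro power_mono) auto
    then show "ennreal ((cmod (1 - cayley s))\<^sup>2) * ennreal (s\<^sup>2) \<le> ennreal (2\<^sup>2)"
      by (simp add: power_mult_distrib mult.commute ennreal_leI flip: ennreal_mult' del: ennreal_numeral)
  qed
  also have "\<dots> < \<infinity>" by (simp add: emeasure_eq_measure ennreal_mult_less_top)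
  finally show ?thesis .
qed

lemma first_moment_diff_U:
  "complex_of_real (\<integral>s. s \<partial>scalar_measure (w - U w)) = cinner (\<i> *\<^sub>C (w + U w)) (w - U w)"
proof -
  note [measurable] = borel_measurable_bounded_borel[OF bounded_borel_cayley]
  have bounded: "bounded_borel (\<lambda>s. 1 - cayley s)" "bounded_borel (\<lambda>s. 1 + cayley s)"
    by (intro bounded_borel_diff bounded_borel_add bounded_borel_const bounded_borel_cayley)+
  have "complex_of_real (\<integral>s. s \<partial>scalar_measure (w - U w))
      = (\<integral>s. complex_of_real ((cmod (1 - cayley s))\<^sup>2 * s) \<partial>scalar_measure w)"
    unfolding diff_U_eq_fun_calc scalar_measure_fun_calc[OF bounded(1)]
    by (subst integral_density)
       (simp_all add: integral_complex_of_real del: of_real_mult of_real_power)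
  also have "\<dots> = (\<integral>s. \<i> * (cnj (1 - cayley s) * (1 + cayley s)) \<partial>scalar_measure w)"
  proof (intro Bochner_Integration.integral_cong refl)
    fix s
    have "complex_of_real ((cmod (1 - cayley s))\<^sup>2 * s) = cnj (1 - cayley s) * (of_real s * (1 - cayley s))"
      by (simp add: complex_norm_square del: of_real_power)
    then show "complex_of_real ((cmod (1 - cayley s))\<^sup>2 * s) = \<i> * (cnj (1 - cayley s) * (1 + cayley s))"
      by (simp only: of_real_mult_one_minus_cayley mult.left_commute)
  qed
  also have "\<dots> = \<i> * cinner (w + U w) (w - U w)"
    unfolding diff_U_eq_fun_calc add_U_eq_fun_calc cinner_fun_calc_fun_calc[OF bounded(2,1)] by simp
  finally show ?thesis by (simp only: cinner_scaleC_left)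
qed

end

definition window :: "nat \<Rightarrow> real set" where
  "window n = {- real n..real n}"

lemma borel_window [measurable]: "window n \<in> sets borel"
  by (simp add: window_def)

lemma eventually_mem_window: "\<forall>\<^sub>F n in sequentially. s \<in> window n"
proof -
  obtain n0 :: nat where "\<bar>s\<bar> \<le> real n0" using real_arch_simple by blast
  then show ?thesis by (intro eventually_sequentiallyI[of n0]) (auto simp: window_def)
qed

context unitary_operator_dense
begin

lemma spec_proj_window_tendsto: "(\<lambda>n. spec_proj (window n) x) \<longlonglongrightarrow> x"
proof -
  have "(\<lambda>n. fun_calc (indicator (window n)) x) \<longlonglongrightarrow> fun_calc (\<lambda>s. 1) x"
  proof (rule fun_calc_tendsto[where K = 1])
    show "(\<lambda>n. indicator (window n) s) \<longlonglongrightarrow> (1::complex)" for s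
      by (rule tendsto_eventually[OF eventually_mono[OF eventually_mem_window[of s]]]) simp
  qed (auto simp: indicator_def)
  then show ?thesis by (simp add: spec_proj_def fun_calc_1)
qed

lemma spec_proj_window_eq_diff_U:
  assumes second_moment: "(\<integral>\<^sup>+s. ennreal (s\<^sup>2) \<partial>scalar_measure x) < \<infinity>"
  obtains w where "spec_proj (window n) x = w - U w"
    "(norm (w + U w))\<^sup>2 \<le> (\<integral>s. s\<^sup>2 \<partial>scalar_measure x)"
proof -
  define f where "f s = indicator (window n) s * inverse (1 - cayley s)" for s
  have nonzero: "1 - cayley s \<noteq> 0" for s
    using of_real_plus_minus_ii_nonzero(1)[of s] by (simp add: one_minus_cayley)
  have f: "bounded_borel f"
    unfolding f_def using nonzero
    by (intro bounded_borel_indicator_times_continuous continuous_intros continuous_on_cayley)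
       (auto simp: window_def)
  have "spec_proj (window n) x = fun_calc (\<lambda>s. (1 - cayley s) * f s) x"
    using nonzero
    by (auto simp: spec_proj_def f_def fun_eq_iff intro!: arg_cong2[where f = fun_calc])
  then have diff: "spec_proj (window n) x = fun_calc f x - U (fun_calc f x)"
    using f
    by (simp add: diff_U_eq_fun_calc fun_calc_fun_calc bounded_borel_diff bounded_borel_cayley)
  have sq: "(cmod ((1 + cayley s) * f s))\<^sup>2 = indicator (window n) s * s\<^sup>2" for s
  proof -
    have "\<i> * ((1 + cayley s) * f s) = of_real s * indicator (window n) s"
      using nonzero[of s] by (simp add: f_def flip: mult.assoc of_real_mult_one_minus_cayley)
    from arg_cong[OF this, of cmod] show ?thesis
      by (simp add: norm_mult power_mult_distrib indicator_def)
  qed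
  have "bounded_borel (\<lambda>s. (1 + cayley s) * f s)"
    by (intro bounded_borel_mult bounded_borel_add bounded_borel_const bounded_borel_cayley f)
  then have "(norm (fun_calc f x + U (fun_calc f x)))\<^sup>2 = (\<integral>s. indicator (window n) s * s\<^sup>2 \<partial>scalar_measure x)"
    unfolding add_U_eq_fun_calc using f
    by (simp add: fun_calc_fun_calc norm_fun_calc_sq bounded_borel_add bounded_borel_cayley sq)
  also have "\<dots> \<le> (\<integral>s. s\<^sup>2 \<partial>scalar_measure x)"
    using second_moment
    by (intro integral_mono_AE' AE_I2 integrableI_bounded) (auto simp: indicator_def)
  finally show ?thesis using that diff by blast
qed

end

section \<open>The spectral theorem\<close>

context self_adjoint_operator
begin

theorem spectral_measure_exists: "\<exists>E. spectral_measure D A E"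
proof -
  let ?U = "cayley_transform \<i>"
  note ii = imaginary_unit.simps(1) complex_i_not_zero
  have range: "range (\<lambda>w. w - ?U w) = D" by (rule range_one_minus_cayley_transform[OF ii])
  interpret unitary_operator_dense ?U
    by standard (simp_all add: range dense_dom cayley_transform_add[OF ii] cayley_transform_scaleC[OF ii]
        cinner_cayley_transform[OF ii] surj_cayley_transform[OF ii])
  have diff_U_mem: "w - ?U w \<in> D" for w using range by auto
  have eq_diff_U: "\<exists>w. x = w - ?U w" if "x \<in> D" for x using that range by (metis imageE)
  have A_diff_U: "A (w - ?U w) = \<i> *\<^sub>C (w + ?U w)" for w
    by (rule A_one_minus_cayley_transform[OF ii])
  have "x \<in> D" if second_moment: "(\<integral>\<^sup>+s. ennreal (s\<^sup>2) \<partial>scalar_measure x) < \<infinity>" for x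
  proof (rule mem_dom_if_limit_with_bounded_images[OF _ spec_proj_window_tendsto])
    fix n
    obtain w where w: "spec_proj (window n) x = w - ?U w" "(norm (w + ?U w))\<^sup>2 \<le> (\<integral>s. s\<^sup>2 \<partial>scalar_measure x)"
      using spec_proj_window_eq_diff_U[OF second_moment] by blast
    show "spec_proj (window n) x \<in> D" unfolding w(1) by (rule diff_U_mem)
    show "norm (A (spec_proj (window n) x)) \<le> sqrt (\<integral>s. s\<^sup>2 \<partial>scalar_measure x)"
      unfolding w(1) A_diff_U using real_le_rsqrt[OF w(2)] by (simp add: norm_scaleC)
  qed
  then have dom_eq: "D = {x. (\<integral>\<^sup>+s. ennreal (s\<^sup>2) \<partial>scalar_measure x) < \<infinity>}"
    using second_moment_diff_U eq_diff_U by blast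
  have "spectral_measure D A spec_proj"
    unfolding spectral_measure_def spectral_scalar_spec_proj
  proof (intro conjI ballI allI impI)
    show "D = {x. (\<integral>\<^sup>+s. ennreal (s\<^sup>2) \<partial>scalar_measure x) < \<infinity>}" by (rule dom_eq)
    show "cinner (A x) x = complex_of_real (\<integral>s. s \<partial>scalar_measure x)" if "x \<in> D" for x
      using eq_diff_U[OF that] first_moment_diff_U A_diff_U by auto
  qed (use orth_proj_spec_proj spec_proj_UNIV spec_proj_Int spec_proj_countably_additive in auto)
  then show ?thesis by blast
qed

lemma spectral_measure_spec_meas: "spectral_measure D A (spec_meas D A)"
  unfolding spec_meas_def by (rule someI_ex[OF spectral_measure_exists])

end

section \<open>Quadratic forms of self-adjoint operators\<close>

lemma nn_integral_le_add_measure: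
  assumes sets: "sets M = sets N" "sets M' = sets N"
    and le: "\<And>B. B \<in> sets N \<Longrightarrow> emeasure N B \<le> emeasure M B + emeasure M' B"
    and f: "f \<in> borel_measurable N"
  shows "(\<integral>\<^sup>+x. f x \<partial>N) \<le> (\<integral>\<^sup>+x. f x \<partial>M) + (\<integral>\<^sup>+x. f x \<partial>M')"
proof -
  note [measurable_cong] = sets
  show ?thesis using f
  proof (induction rule: borel_measurable_induct)
    case (cong f g)
    note space = sets_eq_imp_space_eq[OF sets(1)] sets_eq_imp_space_eq[OF sets(2)]
    have "(\<integral>\<^sup>+x. f x \<partial>K) = (\<integral>\<^sup>+x. g x \<partial>K)" if "space K = space N" for K
      using cong that by (intro nn_integral_cong) auto
    then show ?case using cong space by simp
  next
    case (set B)
    then show ?case by (simp add: sets le)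
  next
    case (mult u c)
    then have "c * (\<integral>\<^sup>+x. u x \<partial>N) \<le> c * ((\<integral>\<^sup>+x. u x \<partial>M) + (\<integral>\<^sup>+x. u x \<partial>M'))"
      by (intro mult_left_mono) auto
    then show ?case using mult by (simp add: nn_integral_cmult distrib_left)
  next
    case (add u v)
    then show ?case using add_mono[OF add.IH] by (simp add: nn_integral_add add_ac)
  next
    case (seq U)
    have "(\<integral>\<^sup>+x. U i x \<partial>N) \<le> (\<integral>\<^sup>+x. (SUP i. U i x) \<partial>M) + (\<integral>\<^sup>+x. (SUP i. U i x) \<partial>M')" for i
      by (rule order_trans[OF seq.IH]) (auto intro!: add_mono nn_integral_mono SUP_upper)
    then have "(SUP i. \<integral>\<^sup>+x. U i x \<partial>N) \<le> (\<integral>\<^sup>+x. (SUP i. U i x) \<partial>M) + (\<integral>\<^sup>+x. (SUP i. U i x) \<partial>M')"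
      by (rule SUP_least)
    then show ?case using seq by (simp add: nn_integral_monotone_convergence_SUP image_comp)
  qed
qed

locale spectral_resolution =
  fixes D :: "'a::chilbert_space set" and A :: "'a \<Rightarrow> 'a" and E :: "real set \<Rightarrow> 'a \<Rightarrow> 'a"
  assumes spectral: "spectral_measure D A E"
begin

abbreviation "\<nu> \<equiv> spectral_scalar E"

lemma
  assumes "B \<in> sets borel"
  shows E_add: "E B (x + y) = E B x + E B y"
    and E_scaleC: "E B (c *\<^sub>C x) = c *\<^sub>C E B x"
    and E_sym: "cinner (E B x) y = cinner x (E B y)"
    and E_E: "C \<in> sets borel \<Longrightarrow> E B (E C x) = E (B \<inter> C) x"
  using spectral assms unfolding spectral_measure_def orth_proj_def by simp_all

lemma E_UNIV: "E UNIV x = x"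
  and E_tendsto: "range F \<subseteq> sets borel \<Longrightarrow> disjoint_family F \<Longrightarrow>
    (\<lambda>n. \<Sum>i<n. E (F i) x) \<longlonglongrightarrow> E (\<Union>i. F i) x"
  and dom_iff: "x \<in> D \<longleftrightarrow> (\<integral>\<^sup>+s. ennreal (s\<^sup>2) \<partial>\<nu> x) < \<infinity>"
  and cinner_A_eq_integral: "x \<in> D \<Longrightarrow> cinner (A x) x = complex_of_real (\<integral>s. s \<partial>\<nu> x)"
  using spectral unfolding spectral_measure_def by simp_all

lemma norm_E_sq: "B \<in> sets borel \<Longrightarrow> (norm (E B x))\<^sup>2 = Re (cinner x (E B x))"
  by (simp add: norm_sq_eq_cinner E_sym E_E)

lemma E_empty: "E {} x = 0"
proof -
  have "(\<lambda>n. \<Sum>i<n. E {} x) \<longlonglongrightarrow> E {} x"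
    using E_tendsto[of "\<lambda>_. {}"] by (simp add: disjoint_family_on_def)
  then have "(\<lambda>n. (\<Sum>i<Suc n. E {} x) - (\<Sum>i<n. E {} x)) \<longlonglongrightarrow> E {} x - E {} x"
    by (intro tendsto_diff LIMSEQ_Suc)
  then show ?thesis by (simp add: LIMSEQ_const_iff)
qed

lemma E_Compl:
  assumes B: "B \<in> sets borel" shows "E B x + E (- B) x = x"
proof -
  have "range (binaryset B (- B)) \<subseteq> sets borel" using B by (auto simp: range_binaryset_eq)
  moreover have "disjoint_family (binaryset B (- B))"
    by (auto simp: disjoint_family_on_def binaryset_def)
  ultimately have "(\<lambda>n. \<Sum>i<n. E (binaryset B (- B) i) x) \<longlonglongrightarrow> E (\<Union>i. binaryset B (- B) i) x"
    by (rule E_tendsto)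
  moreover have "(\<lambda>n. \<Sum>i<n. E (binaryset B (- B) i) x) \<longlonglongrightarrow> E B x + E (- B) x"
    by (rule LIMSEQ_binaryset[where f = "\<lambda>B. E B x"]) (rule E_empty)
  ultimately show ?thesis
    using LIMSEQ_unique by (fastforce simp: UN_binaryset_eq E_UNIV)
qed

lemma sets_\<nu> [measurable_cong, simp]: "sets (\<nu> x) = sets borel"
  unfolding spectral_scalar_def using sets.sigma_sets_eq[of borel] by simp

lemma space_\<nu> [simp]: "space (\<nu> x) = UNIV"
  using sets_eq_imp_space_eq[OF sets_\<nu>] by simp

lemma emeasure_\<nu>:
  assumes B: "B \<in> sets borel" shows "emeasure (\<nu> x) B = ennreal ((norm (E B x))\<^sup>2)"
proof (rule emeasure_measure_of[OF spectral_scalar_def])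
  show "positive (sets (\<nu> x)) (\<lambda>B. ennreal ((norm (E B x))\<^sup>2))"
    by (simp add: positive_def E_empty)
  show "countably_additive (sets (\<nu> x)) (\<lambda>B. ennreal ((norm (E B x))\<^sup>2))"
    unfolding countably_additive_def
  proof (intro allI impI)
    fix F :: "nat \<Rightarrow> real set"
    assume F: "range F \<subseteq> sets (\<nu> x)" "disjoint_family F" "(\<Union>i. F i) \<in> sets (\<nu> x)"
    have Fi: "F i \<in> sets borel" for i using F by auto
    have "(\<lambda>n. Re (cinner x (\<Sum>i<n. E (F i) x))) \<longlonglongrightarrow> Re (cinner x (E (\<Union>i. F i) x))"
      using F by (intro tendsto_Re tendsto_cinner_right E_tendsto) auto
    then have "(\<lambda>i. (norm (E (F i) x))\<^sup>2) sums (norm (E (\<Union>i. F i) x))\<^sup>2"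
      using Fi F(3) unfolding sums_def by (simp add: norm_E_sq cinner_sum_right)
    then show "(\<Sum>i. ennreal ((norm (E (F i) x))\<^sup>2)) = ennreal ((norm (E (\<Union>i. F i) x))\<^sup>2)"
      by (intro suminf_ennreal_eq) auto
  qed
qed (use B in auto)

lemma finite_\<nu>: "finite_measure (\<nu> x)"
  by (rule finite_measureI) (simp add: emeasure_\<nu>)

lemma \<nu>_scaleC: "\<nu> (c *\<^sub>C x) = density (\<nu> x) (\<lambda>_. ennreal ((cmod c)\<^sup>2))"
  by (rule measure_eqI)
     (auto simp: emeasure_\<nu> E_scaleC norm_scaleC power_mult_distrib emeasure_density_const ennreal_mult)

lemma \<nu>_E:
  assumes B [measurable]: "B \<in> sets borel"
  shows "\<nu> (E B x) = density (\<nu> x) (\<lambda>s. ennreal (indicator B s))"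
proof (rule measure_eqI)
  fix C assume "C \<in> sets (\<nu> (E B x))"
  then have C [measurable]: "C \<in> sets borel" by simp
  have "emeasure (density (\<nu> x) (\<lambda>s. ennreal (indicator B s))) C = (\<integral>\<^sup>+s. indicator (C \<inter> B) s \<partial>\<nu> x)"
    by (auto simp: emeasure_density indicator_def intro!: nn_integral_cong)
  then show "emeasure (\<nu> (E B x)) C = emeasure (density (\<nu> x) (\<lambda>s. ennreal (indicator B s))) C"
    by (simp add: emeasure_\<nu> E_E)
qed simp

lemma nn_integral_\<nu>_add_le:
  assumes [measurable]: "f \<in> borel_measurable borel"
  shows "(\<integral>\<^sup>+s. f s \<partial>\<nu> (x + y)) \<le> 2 * (\<integral>\<^sup>+s. f s \<partial>\<nu> x) + 2 * (\<integral>\<^sup>+s. f s \<partial>\<nu> y)"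
proof -
  have "(\<integral>\<^sup>+s. f s \<partial>\<nu> (x + y)) \<le> (\<integral>\<^sup>+s. f s \<partial>scale_measure 2 (\<nu> x)) + (\<integral>\<^sup>+s. f s \<partial>scale_measure 2 (\<nu> y))"
  proof (rule nn_integral_le_add_measure)
    fix B assume "B \<in> sets (\<nu> (x + y))"
    then have B: "B \<in> sets borel" by simp
    have "(norm (E B (x + y)))\<^sup>2 \<le> 2 * (norm (E B x))\<^sup>2 + 2 * (norm (E B y))\<^sup>2"
      using parallelogram_law[of "E B x" "E B y"] zero_le_power2[of "norm (E B x - E B y)"]
      unfolding E_add[OF B] by linarith
    then have "ennreal ((norm (E B (x + y)))\<^sup>2) \<le> ennreal (2 * (norm (E B x))\<^sup>2 + 2 * (norm (E B y))\<^sup>2)"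
      by (rule ennreal_leI)
    then show "emeasure (\<nu> (x + y)) B \<le> emeasure (scale_measure 2 (\<nu> x)) B + emeasure (scale_measure 2 (\<nu> y)) B"
      by (simp add: emeasure_\<nu> B ennreal_plus ennreal_mult)
  qed simp_all
  then show ?thesis by (simp add: nn_integral_scale_measure)
qed

lemma E_window_dom: "E (window n) x \<in> D"
proof -
  interpret finite_measure "\<nu> x" by (rule finite_\<nu>)
  have "(\<integral>\<^sup>+s. ennreal (s\<^sup>2) \<partial>\<nu> (E (window n) x)) = (\<integral>\<^sup>+s. ennreal (indicator (window n) s) * ennreal (s\<^sup>2) \<partial>\<nu> x)"
    by (simp add: \<nu>_E nn_integral_density)
  also have "\<dots> \<le> (\<integral>\<^sup>+s. ennreal ((real n)\<^sup>2) \<partial>\<nu> x)"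
  proof (intro nn_integral_mono)
    show "ennreal (indicator (window n) s) * ennreal (s\<^sup>2) \<le> ennreal ((real n)\<^sup>2)" for s
      by (cases "s \<in> window n")
         (auto simp: window_def abs_le_square_iff[symmetric] intro!: ennreal_leI)
  qed
  also have "\<dots> < \<infinity>" by (simp add: emeasure_eq_measure ennreal_mult_less_top)
  finally show ?thesis by (simp add: dom_iff)
qed

lemma tendsto_integral_window:
  fixes f :: "real \<Rightarrow> real"
  assumes f: "integrable (\<nu> x) f"
  shows "(\<lambda>n. \<integral>s. indicator (window n) s * f s \<partial>\<nu> x) \<longlonglongrightarrow> (\<integral>s. f s \<partial>\<nu> x)"
proof (rule integral_dominated_convergence[OF _ _ integrable_norm[OF f]])
  have "(\<lambda>n. indicator (window n) s * f s) \<longlonglongrightarrow> f s" for s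
    by (rule tendsto_eventually[OF eventually_mono[OF eventually_mem_window[of s]]]) simp
  then show "AE s in \<nu> x. (\<lambda>n. indicator (window n) s * f s) \<longlonglongrightarrow> f s" by simp
  show "(\<lambda>s. indicator (window n) s * f s) \<in> borel_measurable (\<nu> x)" for n
    using borel_measurable_integrable[OF f] by measurable
qed (use f in \<open>auto simp: indicator_def\<close>)

lemma tendsto_integral_Compl_window:
  fixes f :: "real \<Rightarrow> real"
  assumes f: "integrable (\<nu> x) f"
  shows "(\<lambda>n. \<integral>s. indicator (- window n) s * f s \<partial>\<nu> x) \<longlonglongrightarrow> 0"
proof -
  have "integrable (\<nu> x) (\<lambda>s. indicator (window n) s * f s)" for n
    using integrable_mult_indicator[OF _ f, of "window n"] by simp
  then have "(\<integral>s. indicator (- window n) s * f s \<partial>\<nu> x)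
      = (\<integral>s. f s \<partial>\<nu> x) - (\<integral>s. indicator (window n) s * f s \<partial>\<nu> x)" for n
    by (simp add: f indicator_compl left_diff_distrib)
  then show ?thesis
    using tendsto_diff[OF tendsto_const[of "\<integral>s. f s \<partial>\<nu> x"] tendsto_integral_window[OF f]] by simp
qed

lemma E_window_tendsto: "(\<lambda>n. E (window n) x) \<longlonglongrightarrow> x"
proof (rule tendsto_if_norm_diff_sq_tendsto_0)
  interpret finite_measure "\<nu> x" by (rule finite_\<nu>)
  have "(norm (E (window n) x - x))\<^sup>2 = (\<integral>s. indicator (- window n) s * 1 \<partial>\<nu> x)" for n
  proof -
    have "E (window n) x - x = - E (- window n) x"
      using E_Compl[OF borel_window, of n x] by (simp add: algebra_simps)
    then show ?thesis by (simp add: borel_comp measure_def emeasure_\<nu>)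
  qed
  then show "(\<lambda>n. (norm (E (window n) x - x))\<^sup>2) \<longlonglongrightarrow> 0"
    using tendsto_integral_Compl_window[of x "\<lambda>_. 1"] by simp
qed

end

sublocale self_adjoint_operator \<subseteq> spectral_resolution D A "spec_meas D A"
  by standard (rule spectral_measure_spec_meas)

context self_adjoint_operator
begin

abbreviation "E \<equiv> spec_meas D A"

lemma form_dom_iff_integrable: "x \<in> form_dom D A \<longleftrightarrow> integrable (\<nu> x) (\<lambda>s. s)"
  by (simp add: form_dom_def integrable_iff_bounded)

lemma form_eq_cinner: "x \<in> D \<Longrightarrow> form D A x = Re (cinner (A x) x)"
  by (simp add: form_def cinner_A_eq_integral)

lemma form_scaleC: "form D A (c *\<^sub>C x) = (cmod c)\<^sup>2 * form D A x"
  unfolding form_def \<nu>_scaleC by (subst integral_density) auto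

lemma dom_subset_form_dom: "D \<subseteq> form_dom D A"
proof
  fix x assume "x \<in> D"
  then have second_moment: "(\<integral>\<^sup>+s. ennreal (s\<^sup>2) \<partial>\<nu> x) < \<infinity>" by (simp add: dom_iff)
  interpret finite_measure "\<nu> x" by (rule finite_\<nu>)
  have "(\<integral>\<^sup>+s. ennreal \<bar>s\<bar> \<partial>\<nu> x) \<le> (\<integral>\<^sup>+s. 1 + ennreal (s\<^sup>2) \<partial>\<nu> x)"
  proof (intro nn_integral_mono)
    fix s :: real
    have "\<bar>s\<bar> \<le> 1 + s\<^sup>2"
      using sum_squares_bound[of "\<bar>s\<bar>" 1] zero_le_power2[of s] by simp
    then show "ennreal \<bar>s\<bar> \<le> 1 + ennreal (s\<^sup>2)"
      by (metis ennreal_1 ennreal_leI ennreal_plus zero_le_one zero_le_power2)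
  qed
  also have "\<dots> = emeasure (\<nu> x) UNIV + (\<integral>\<^sup>+s. ennreal (s\<^sup>2) \<partial>\<nu> x)"
    by (simp add: nn_integral_add)
  also have "\<dots> < \<infinity>" using second_moment by (simp add: emeasure_eq_measure)
  finally show "x \<in> form_dom D A" by (simp add: form_dom_def)
qed

lemma csubspace_form_dom: "csubspace (form_dom D A)"
  unfolding csubspace_def
proof (intro conjI ballI allI)
  show "0 \<in> form_dom D A" using zero_dom dom_subset_form_dom by blast
  fix x assume x: "x \<in> form_dom D A"
  then show "c *\<^sub>C x \<in> form_dom D A" for c
    by (simp add: form_dom_def \<nu>_scaleC nn_integral_density nn_integral_cmult ennreal_mult_less_top)
  fix y assume y: "y \<in> form_dom D A"
  have "(\<integral>\<^sup>+s. ennreal \<bar>s\<bar> \<partial>\<nu> (x + y)) \<le> 2 * (\<integral>\<^sup>+s. ennreal \<bar>s\<bar> \<partial>\<nu> x) + 2 * (\<integral>\<^sup>+s. ennreal \<bar>s\<bar> \<partial>\<nu> y)"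
    by (rule nn_integral_\<nu>_add_le) simp
  also have "\<dots> < \<infinity>" using x y by (simp add: form_dom_def ennreal_mult_less_top)
  finally show "x + y \<in> form_dom D A" by (simp add: form_dom_def)
qed

lemmas add_form_dom = csubspace_add[OF csubspace_form_dom]
  and scaleC_form_dom = csubspace_scaleC[OF csubspace_form_dom]

lemma form_E: "B \<in> sets borel \<Longrightarrow> form D A (E B x) = (\<integral>s. indicator B s * s \<partial>\<nu> x)"
  unfolding form_def \<nu>_E by (subst integral_density) auto

lemma form_eq_form_E_add_form_E_Compl:
  assumes x: "x \<in> form_dom D A" and B: "B \<in> sets borel"
  shows "form D A x = form D A (E B x) + form D A (E (- B) x)"
proof -
  have int: "integrable (\<nu> x) (\<lambda>s. indicator C s * s)" if "C \<in> sets borel" for C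
    using x that integrable_mult_indicator[of C "\<nu> x" "\<lambda>s. s"]
    by (simp add: form_dom_iff_integrable)
  have "form D A x = (\<integral>s. indicator B s * s + indicator (- B) s * s \<partial>\<nu> x)"
    unfolding form_def by (intro Bochner_Integration.integral_cong) (auto simp: indicator_def)
  also have "\<dots> = form D A (E B x) + form D A (E (- B) x)"
    using B by (simp add: form_E int borel_comp)
  finally show ?thesis .
qed

lemma form_E_window_tendsto:
  assumes "x \<in> form_dom D A"
  shows "(\<lambda>n. form D A (E (window n) x)) \<longlonglongrightarrow> form D A x"
    and "(\<lambda>n. form D A (E (- window n) x)) \<longlonglongrightarrow> 0"
  using assms tendsto_integral_window[of x "\<lambda>s. s"] tendsto_integral_Compl_window[of x "\<lambda>s. s"]
  unfolding form_dom_iff_integrable form_E[OF borel_window] form_E[OF borel_comp[OF borel_window]]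
    form_def[of D A x] by auto

lemma form_add_dom:
  assumes x: "x \<in> D" and y: "y \<in> D"
  shows "form D A (x + y) = form D A x + 2 * Re (cinner x (A y)) + form D A y"
  using x y add_dom A_sym[OF x y] Re_cinner_commute[of "A y" x]
  by (simp add: form_eq_cinner A_add cinner_simps)

text \<open>The identity extends from \<open>D\<close> because \<open>E(window n) x + y\<close> agrees with \<open>x + y\<close> on \<open>window n\<close>
  and with \<open>y\<close> off it.\<close>
lemma form_add:
  assumes x: "x \<in> form_dom D A" and y: "y \<in> D"
  shows "form D A (x + y) = form D A x + 2 * Re (cinner x (A y)) + form D A y"
proof (rule LIMSEQ_unique)
  have y': "y \<in> form_dom D A" using y dom_subset_form_dom by blast
  have xy: "x + y \<in> form_dom D A" by (intro add_form_dom x y')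
  have "form D A (E (window n) x + y) = form D A (E (window n) (x + y)) + form D A (E (- window n) y)" for n
  proof -
    note B = borel_window[of n] borel_comp[OF borel_window[of n]]
    let ?z = "E (window n) x + y"
    have "?z \<in> form_dom D A"
      using add_form_dom E_window_dom y' dom_subset_form_dom by blast
    moreover have "E (window n) ?z = E (window n) (x + y)" "E (- window n) ?z = E (- window n) y"
      using B by (simp_all add: E_add E_E E_empty)
    ultimately show ?thesis using form_eq_form_E_add_form_E_Compl[OF _ B(1), of ?z] by simp
  qed
  moreover have "(\<lambda>n. form D A (E (window n) (x + y)) + form D A (E (- window n) y)) \<longlonglongrightarrow> form D A (x + y) + 0"
    by (intro tendsto_add form_E_window_tendsto xy y')
  ultimately show "(\<lambda>n. form D A (E (window n) x + y)) \<longlonglongrightarrow> form D A (x + y)" by simp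
  have "(\<lambda>n. form D A (E (window n) x) + 2 * Re (cinner (E (window n) x) (A y)) + form D A y)
      \<longlonglongrightarrow> form D A x + 2 * Re (cinner x (A y)) + form D A y"
    by (intro tendsto_intros form_E_window_tendsto x tendsto_cinner_left E_window_tendsto)
  then show "(\<lambda>n. form D A (E (window n) x + y)) \<longlonglongrightarrow> form D A x + 2 * Re (cinner x (A y)) + form D A y"
    by (simp add: form_add_dom E_window_dom y)
qed

end

section \<open>Approximate kernels and maximal non-negative subspaces\<close>

context self_adjoint_operator
begin

lemma form_lower_bound_plus_approximate_kernel:
  assumes x: "x \<in> form_dom D A" and v: "v \<in> D" "norm v = 1" "norm (A v) \<le> \<eta>"
    and lower: "form D A x \<ge> a * (norm x)\<^sup>2" and \<eta>: "0 \<le> \<eta>" "5 * \<eta> \<le> a"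
  shows "form D A (x + c *\<^sub>C v) \<ge> - 4 * \<eta> * (norm (x + c *\<^sub>C v))\<^sup>2"
proof -
  define u where "u = x + c *\<^sub>C v"
  have cv: "c *\<^sub>C v \<in> D" "norm (c *\<^sub>C v) = cmod c" using scaleC_dom v by (auto simp: norm_scaleC)
  have A_cv: "norm (A (c *\<^sub>C v)) \<le> \<eta> * cmod c"
    using mult_left_mono[OF v(3), of "cmod c"] by (simp add: A_scaleC v(1) norm_scaleC mult.commute)
  have "\<bar>Re (cinner x (A (c *\<^sub>C v)))\<bar> \<le> norm x * (\<eta> * cmod c)"
    by (rule order_trans[OF abs_Re_cinner_le mult_left_mono[OF A_cv norm_ge_zero]])
  moreover have "\<bar>form D A (c *\<^sub>C v)\<bar> \<le> \<eta> * cmod c * cmod c"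
    using order_trans[OF abs_Re_cinner_le mult_right_mono[OF A_cv norm_ge_zero], of "c *\<^sub>C v"] cv
    by (simp add: form_eq_cinner)
  ultimately have "form D A u \<ge> a * (norm x)\<^sup>2 - 2 * (norm x * (\<eta> * cmod c)) - \<eta> * cmod c * cmod c"
    using lower form_add[OF x cv(1)] unfolding u_def by linarith
  moreover have "\<eta> * (2 * norm x * cmod c) \<le> \<eta> * ((norm x)\<^sup>2 + (cmod c)\<^sup>2)"
    using sum_squares_bound[of "norm x" "cmod c"] \<eta> by (intro mult_left_mono) auto
  moreover have "\<eta> * (cmod c)\<^sup>2 \<le> \<eta> * (2 * (norm u)\<^sup>2 + 2 * (norm x)\<^sup>2)"
  proof (intro mult_left_mono \<eta>)
    have "cmod c \<le> norm u + norm x"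
      using norm_triangle_ineq4[of u x] by (simp add: u_def cv)
    then have "(cmod c)\<^sup>2 \<le> (norm u + norm x)\<^sup>2" by (intro power_mono) auto
    also have "\<dots> \<le> 2 * (norm u)\<^sup>2 + 2 * (norm x)\<^sup>2"
      using sum_squares_bound[of "norm u" "norm x"] by (simp add: power2_sum)
    finally show "(cmod c)\<^sup>2 \<le> 2 * (norm u)\<^sup>2 + 2 * (norm x)\<^sup>2" .
  qed
  moreover have "5 * \<eta> * (norm x)\<^sup>2 \<le> a * (norm x)\<^sup>2" using \<eta> by (intro mult_right_mono) auto
  ultimately have "form D A u \<ge> - 4 * \<eta> * (norm u)\<^sup>2"
    by (simp add: algebra_simps power2_eq_square)
  then show ?thesis by (simp add: u_def)
qed

lemma form_le_if_negative_gap: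
  assumes q_scaleC: "\<And>c x. q (c *\<^sub>C x) = (cmod c)\<^sup>2 * q x"
    and gap: "\<And>x. x \<in> form_dom D A \<Longrightarrow> norm x = 1 \<Longrightarrow> q x < 0 \<Longrightarrow> form D A x \<le> - m"
    and x: "x \<in> form_dom D A" "q x < 0"
  shows "form D A x \<le> - m * (norm x)\<^sup>2"
proof -
  have "x \<noteq> 0" using x(2) q_scaleC[of 0 0] by auto
  have "sgn x \<in> form_dom D A"
    unfolding sgn_eq_scaleC by (intro scaleC_form_dom x)
  moreover have scale: "q x = (norm x)\<^sup>2 * q (sgn x)" "form D A x = (norm x)\<^sup>2 * form D A (sgn x)"
    using q_scaleC[of "of_real (norm x)" "sgn x"] form_scaleC[of "of_real (norm x)" "sgn x"]
    by (simp_all add: scaleC_norm_sgn)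
  moreover have "q (sgn x) < 0" using x(2) by (simp add: scale mult_less_0_iff)
  ultimately have "form D A (sgn x) \<le> - m" using \<open>x \<noteq> 0\<close> by (intro gap) (auto simp: norm_sgn)
  from mult_left_mono[OF this, of "(norm x)\<^sup>2"] show ?thesis by (simp add: scale(2) mult.commute)
qed

end

lemma mem_max_nonneg_subspace:
  assumes M: "M \<in> max_nonneg_subspaces \<D> q" and \<D>: "csubspace \<D>" and v: "v \<in> \<D>"
    and nonneg: "\<And>x c. x \<in> M \<Longrightarrow> q (x + c *\<^sub>C v) \<ge> 0"
  shows "v \<in> M"
proof -
  define L where "L = {x + c *\<^sub>C v |x c. x \<in> M}"
  have sub: "csubspace M" "M \<subseteq> \<D>" using M by (auto simp: max_nonneg_subspaces_def)
  have mem: "x + c *\<^sub>C v \<in> L" if "x \<in> M" for x c using that by (auto simp: L_def)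
  have "csubspace L" unfolding L_def by (rule csubspace_plus_line[OF sub(1)])
  moreover have "L \<subseteq> \<D>" using sub v csubspaceD[OF \<D>] by (auto simp: L_def)
  moreover have "\<forall>u\<in>L. q u \<ge> 0" using nonneg by (auto simp: L_def)
  moreover have "M \<subseteq> L" using mem[of _ 0] by auto
  ultimately have "L = M" using M by (auto simp: max_nonneg_subspaces_def)
  then show ?thesis using mem[of 0 1] csubspace_zero[OF sub(1)] by (simp add: scaleC_one)
qed

theorem (in self_adjoint_operator) zero_in_resolvent_if_max_nonneg_subspace:
  assumes M: "M \<in> max_nonneg_subspaces (form_dom D A) q"
    and q_scaleC: "\<And>c x. q (c *\<^sub>C x) = (cmod c)\<^sup>2 * q x"
    and gap: "m > 0" "\<And>x. x \<in> form_dom D A \<Longrightarrow> norm x = 1 \<Longrightarrow> q x < 0 \<Longrightarrow> form D A x \<le> - m"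
    and lower: "a > 0" "\<And>x. x \<in> M \<Longrightarrow> form D A x \<ge> a * (norm x)\<^sup>2"
  shows "zero_in_resolvent D A"
proof (rule ccontr)
  assume not_resolvent: "\<not> zero_in_resolvent D A"
  define \<eta> where "\<eta> = min (a / 5) (m / 8)"
  have \<eta>: "\<eta> > 0" "5 * \<eta> \<le> a" "4 * \<eta> < m" using lower(1) gap(1) by (auto simp: \<eta>_def)
  obtain v where v: "v \<in> D" "norm v = 1" "norm (A v) < \<eta>"
    using approximate_kernel_if_not_resolvent[OF not_resolvent \<eta>(1)] by blast
  have v_dom: "v \<in> form_dom D A" using v(1) dom_subset_form_dom by blast
  have "v \<in> M"
  proof (rule mem_max_nonneg_subspace[OF M csubspace_form_dom v_dom])
    fix x c assume "x \<in> M"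
    then have x: "x \<in> form_dom D A" using M by (auto simp: max_nonneg_subspaces_def)
    define u where "u = x + c *\<^sub>C v"
    have "u \<in> form_dom D A" unfolding u_def by (intro add_form_dom scaleC_form_dom x v_dom)
    moreover have "form D A u \<ge> - 4 * \<eta> * (norm u)\<^sup>2"
      unfolding u_def using \<eta> v lower(2)[OF \<open>x \<in> M\<close>]
      by (intro form_lower_bound_plus_approximate_kernel x) auto
    ultimately have "m * (norm u)\<^sup>2 \<le> 4 * \<eta> * (norm u)\<^sup>2" if "q u < 0"
      using form_le_if_negative_gap[OF q_scaleC gap(2)] that by fastforce
    moreover have "u \<noteq> 0" if "q u < 0" using that q_scaleC[of 0 0] by auto
    ultimately show "q (x + c *\<^sub>C v) \<ge> 0" using \<eta>(3) by (force simp: u_def)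
  qed
  then have "a \<le> Re (cinner (A v) v)" using lower(2)[of v] v by (simp add: form_eq_cinner)
  also have "\<dots> \<le> norm (A v)" using abs_Re_cinner_le[of "A v" v] v(2) by simp
  finally show False using v(3) \<eta> lower(1) by simp
qed

section \<open>The Virozub--Matsaev condition\<close>

lemma has_real_derivative_le_imp_decrease:
  fixes f f' :: "real \<Rightarrow> real"
  assumes ab: "a < b" and deriv: "\<And>x. x \<in> {a..b} \<Longrightarrow> (f has_real_derivative f' x) (at x within {a..b})"
    and le: "\<And>x. x \<in> {a<..<b} \<Longrightarrow> f' x \<le> - \<delta>"
  shows "f b \<le> f a - \<delta> * (b - a)"
proof -
  have "(f has_derivative (\<lambda>h. f' x * h)) (at x within {a..b})" if "x \<in> {a..b}" for x
    using deriv[OF that] by (simp add: has_field_derivative_def)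
  then obtain x where x: "x \<in> {a<..<b}" "f b - f a = f' x * (b - a)"
    using mvt_simple[of a b f "\<lambda>x h. f' x * h"] ab by auto
  have "f' x * (b - a) \<le> - \<delta> * (b - a)"
    using le[OF x(1)] ab by (intro mult_right_mono) auto
  then show ?thesis using x(2) by simp
qed

lemma decrease_if_steep_above_level:
  fixes f f' :: "real \<Rightarrow> real"
  assumes ab: "a < b" and \<delta>: "\<delta> > 0"
    and deriv: "\<And>x. x \<in> {a..b} \<Longrightarrow> (f has_real_derivative f' x) (at x within {a..b})"
    and steep: "\<And>x. x \<in> {a..b} \<Longrightarrow> - \<epsilon> \<le> f x \<Longrightarrow> f' x \<le> - \<delta>"
  shows "f b \<le> - \<epsilon> \<or> f b \<le> f a - \<delta> * (b - a)"
proof (rule disjCI)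
  assume "\<not> f b \<le> f a - \<delta> * (b - a)"
  then obtain x where x: "x \<in> {a<..<b}" "f x < - \<epsilon>"
    using has_real_derivative_le_imp_decrease[OF ab deriv, of \<delta>] steep by (force simp: not_le)
  define S where "S = {a..b} \<inter> f -` {..- \<epsilon>}"
  have "continuous_on {a..b} f" using deriv by (rule DERIV_continuous_on)
  then have "closed S" unfolding S_def by (intro continuous_closed_preimage) auto
  then have "compact S" by (simp add: S_def compact_eq_bounded_closed bounded_Int)
  moreover have "x \<in> S" using x by (simp add: S_def)
  ultimately obtain s where s: "s \<in> S" "\<And>x. x \<in> S \<Longrightarrow> x \<le> s"
    using compact_attains_sup by (metis empty_iff)
  have "s = b"
  proof (rule ccontr)
    assume "s \<noteq> b"
    then have sb: "s \<in> {a..<b}" using s(1) by (auto simp: S_def)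
    have "f b \<le> f s - \<delta> * (b - s)"
    proof (rule has_real_derivative_le_imp_decrease)
      show "(f has_real_derivative f' x) (at x within {s..b})" if "x \<in> {s..b}" for x
        using that sb by (intro DERIV_subset[OF deriv]) auto
      show "f' x \<le> - \<delta>" if "x \<in> {s<..<b}" for x
        using s(2)[of x] that sb by (intro steep) (force simp: S_def)+
    qed (use sb in auto)
    moreover have "\<delta> * (b - s) > 0" using sb \<delta> by simp
    ultimately have "f b < - \<epsilon>" using s(1) by (simp add: S_def)
    then show False using s(2)[of b] sb by (auto simp: S_def)
  qed
  then show "f b \<le> - \<epsilon>" using s(1) by (simp add: S_def)
qed

lemma negative_beyond_negative:
  fixes f :: "real \<Rightarrow> real"
  assumes "is_interval \<Delta>" and cont: "continuous_on \<Delta> f"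
    and zeros: "\<And>l0 l. l0 \<in> \<Delta> \<Longrightarrow> f l0 = 0 \<Longrightarrow> l \<in> \<Delta> \<Longrightarrow> l < l0 \<Longrightarrow> f l > 0"
    and a: "a \<in> \<Delta>" "f a < 0" and b: "b \<in> \<Delta>" "a \<le> b"
  shows "f b < 0"
proof (rule ccontr)
  assume "\<not> f b < 0"
  have sub: "{a..b} \<subseteq> \<Delta>" using mem_is_interval_1_I[OF assms(1) a(1) b(1)] by auto
  then have "continuous_on {a..b} f" using cont continuous_on_subset by blast
  then obtain l0 where l0: "a \<le> l0" "l0 \<le> b" "f l0 = 0"
    using IVT'[of f a 0 b] \<open>\<not> f b < 0\<close> a(2) b(2) by auto
  then show False using zeros[of l0 a] a sub by (force simp: less_le)
qed

theorem virozub_matsaev_gap: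
  fixes t :: "real \<Rightarrow> 'a::real_normed_vector \<Rightarrow> real"
  assumes interval: "is_interval \<Delta>" and mu: "\<mu>1 \<in> \<Delta>" "\<mu>2 \<in> \<Delta>" "\<mu>1 < \<mu>2"
    and cont: "\<And>x. x \<in> \<D> - {0} \<Longrightarrow> continuous_on \<Delta> (\<lambda>l. t l x)"
    and zeros: "\<And>x l0 l. x \<in> \<D> - {0} \<Longrightarrow> l0 \<in> \<Delta> \<Longrightarrow> t l0 x = 0 \<Longrightarrow> l \<in> \<Delta> \<Longrightarrow> l < l0 \<Longrightarrow> t l x > 0"
    and diff: "\<And>x l. x \<in> \<D> \<Longrightarrow> l \<in> \<Delta> \<Longrightarrow> (\<lambda>s. t s x) differentiable (at l within \<Delta>)"
    and steep: "\<exists>\<epsilon>>0. \<exists>\<delta>>0. \<forall>x\<in>\<D>. norm x = 1 \<longrightarrow> (\<forall>l\<in>{\<mu>1..\<mu>2}. \<forall>d. \<bar>t l x\<bar> \<le> \<epsilon> \<longrightarrow>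
      ((\<lambda>s. t s x) has_real_derivative d) (at l within \<Delta>) \<longrightarrow> d \<le> - \<delta>)"
  obtains m where "m > 0" "\<And>x. x \<in> \<D> \<Longrightarrow> norm x = 1 \<Longrightarrow> t \<mu>1 x < 0 \<Longrightarrow> t \<mu>2 x \<le> - m"
proof -
  obtain \<epsilon> \<delta> where \<epsilon>: "\<epsilon> > 0" and \<delta>: "\<delta> > 0"
    and slope: "\<And>x l d. x \<in> \<D> \<Longrightarrow> norm x = 1 \<Longrightarrow> l \<in> {\<mu>1..\<mu>2} \<Longrightarrow> \<bar>t l x\<bar> \<le> \<epsilon> \<Longrightarrow>
      ((\<lambda>s. t s x) has_real_derivative d) (at l within \<Delta>) \<Longrightarrow> d \<le> - \<delta>"
    using steep by blast
  have sub: "{\<mu>1..\<mu>2} \<subseteq> \<Delta>" using mem_is_interval_1_I[OF interval mu(1,2)] by auto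
  have "t \<mu>2 x \<le> - min \<epsilon> (\<delta> * (\<mu>2 - \<mu>1))" if x: "x \<in> \<D>" "norm x = 1" and neg: "t \<mu>1 x < 0" for x
  proof -
    have x0: "x \<in> \<D> - {0}" using x by auto
    have neg_all: "t l x < 0" if "l \<in> {\<mu>1..\<mu>2}" for l
      using that sub
      by (intro negative_beyond_negative[OF interval cont[OF x0] zeros[OF x0] mu(1) neg]) auto
    obtain f' where f': "\<And>l. l \<in> \<Delta> \<Longrightarrow> ((\<lambda>s. t s x) has_real_derivative f' l) (at l within \<Delta>)"
      using diff[OF x(1)] unfolding real_differentiable_def by metis
    have "t \<mu>2 x \<le> - \<epsilon> \<or> t \<mu>2 x \<le> t \<mu>1 x - \<delta> * (\<mu>2 - \<mu>1)"
    proof (rule decrease_if_steep_above_level[OF mu(3) \<delta>])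
      fix l assume l: "l \<in> {\<mu>1..\<mu>2}"
      show "((\<lambda>s. t s x) has_real_derivative f' l) (at l within {\<mu>1..\<mu>2})"
        using DERIV_subset[OF f' sub] l sub by auto
      show "- \<epsilon> \<le> t l x \<Longrightarrow> f' l \<le> - \<delta>"
        using slope[OF x l _ f'] neg_all[OF l] l sub by auto
    qed
    then show ?thesis using neg by auto
  qed
  moreover have "min \<epsilon> (\<delta> * (\<mu>2 - \<mu>1)) > 0" using \<epsilon> \<delta> mu(3) by simp
  ultimately show ?thesis using that by blast
qed

theorem theorem2p2:
  fixes \<Delta> :: "real set"
    and Tdom :: "real \<Rightarrow> 'a::chilbert_space set"
    and T :: "real \<Rightarrow> 'a \<Rightarrow> 'a"
    and \<D> :: "'a set"
    and t :: "real \<Rightarrow> 'a \<Rightarrow> real"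
    and \<mu>1 \<mu>2 a :: real
    and M :: "'a set"
  defines "t \<equiv> \<lambda>l x. form (Tdom l) (T l) x"
  assumes interval: "is_interval \<Delta>"
    and A1: "\<forall>l\<in>\<Delta>. self_adjoint (Tdom l) (T l)"
    and A2: "\<forall>l\<in>\<Delta>. form_dom (Tdom l) (T l) = \<D>"
    and A3: "\<forall>x\<in>\<D> - {0}. continuous_on \<Delta> (\<lambda>l. t l x) \<and>
               (\<forall>l0\<in>\<Delta>. t l0 x = 0 \<longrightarrow>
                  (\<forall>l\<in>\<Delta>. (l < l0 \<longrightarrow> t l x > 0) \<and> (l > l0 \<longrightarrow> t l x < 0)))"
    and VM_diff: "\<forall>u\<in>\<D>. \<forall>l\<in>\<Delta>. (\<lambda>s. t s u) differentiable (at l within \<Delta>)"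
    and VM: "\<forall>I. compact I \<and> is_interval I \<and> I \<subseteq> \<Delta> \<longrightarrow>
               (\<exists>\<epsilon>>0. \<exists>\<delta>>0. \<forall>x\<in>\<D>. norm x = 1 \<longrightarrow>
                  (\<forall>l\<in>I. \<forall>d. \<bar>t l x\<bar> \<le> \<epsilon> \<longrightarrow>
                     ((\<lambda>s. t s x) has_real_derivative d) (at l within \<Delta>) \<longrightarrow> d \<le> - \<delta>))"
    and mu1: "\<mu>1 \<in> \<Delta>" and mu2: "\<mu>2 \<in> \<Delta>" and mu12: "\<mu>1 < \<mu>2"
    and M: "M \<in> max_nonneg_subspaces \<D> (t \<mu>1)"
    and a_pos: "a > 0"
    and M_unif: "\<forall>x\<in>M. t \<mu>2 x \<ge> a * (norm x)\<^sup>2"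
  shows "zero_in_resolvent (Tdom \<mu>2) (T \<mu>2)"
proof -
  have "{\<mu>1..\<mu>2} \<subseteq> \<Delta>" using mem_is_interval_1_I[OF interval mu1 mu2] by auto
  then obtain m where m: "m > 0" "\<And>x. x \<in> \<D> \<Longrightarrow> norm x = 1 \<Longrightarrow> t \<mu>1 x < 0 \<Longrightarrow> t \<mu>2 x \<le> - m"
    using virozub_matsaev_gap[OF interval mu1 mu2 mu12, of \<D> t] A3 VM_diff VM[rule_format, of "{\<mu>1..\<mu>2}"]
    by (auto simp: is_interval_cc)
  interpret T1: self_adjoint_operator "Tdom \<mu>1" "T \<mu>1" using A1 mu1 by unfold_locales auto
  interpret T2: self_adjoint_operator "Tdom \<mu>2" "T \<mu>2" using A1 mu2 by unfold_locales auto
  have dom: "form_dom (Tdom \<mu>2) (T \<mu>2) = \<D>" using A2 mu2 by blast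
  show ?thesis
  proof (rule T2.zero_in_resolvent_if_max_nonneg_subspace[unfolded dom])
    show "M \<in> max_nonneg_subspaces \<D> (t \<mu>1)" by (rule M)
    show "t \<mu>1 (c *\<^sub>C x) = (cmod c)\<^sup>2 * t \<mu>1 x" for c x unfolding t_def by (rule T1.form_scaleC)
    show "form (Tdom \<mu>2) (T \<mu>2) x \<le> - m" if "x \<in> \<D>" "norm x = 1" "t \<mu>1 x < 0" for x
      using m(2)[OF that] by (simp add: t_def)
    show "form (Tdom \<mu>2) (T \<mu>2) x \<ge> a * (norm x)\<^sup>2" if "x \<in> M" for x
      using M_unif that by (simp add: t_def)
  qed (fact m(1) a_pos)+
qed

end
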